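(* For every $\delta>0$ there exists $\tau>0$ such that for every $\nu>0$ there exist $n_0\in\mathbb{N}$ and a function $\eta:\mathbb{N}\to[0,\infty)$ with $\eta(n)\to 0$ as $n\to\infty$ (both depending only on $\delta,\tau,\nu$) for which the following holds. Let $n\ge n_0$ be even, let $d\ge\delta n$, and let $r\le n^{1/50}$ be a positive integer. Let $G$ be any $d$-regular robust $(\nu,\tau)$-expander on $n$ vertices, let $M$ be chosen uniformly at random from the set of all perfect matchings of $G$, let $N$ be any spanning $r$-regular subgraph of $G$, let $X:=|M\cap E(N)|$, and let $Y$ be a Poisson random variable with parameter $\frac{rn}{2d}$. Then $$d_{\rm TV}(X,Y)\le \eta(n),$$ that is, $d_{\rm TV}(X,Y)=o_n(1)$.
   Context: All graphs are finite and simple. Let $\nu,\tau>0$ and let $G$ be a graph on $n$ vertices. For $S\subseteq V(G)$, the $\nu$-robust neighbourhood $RN_{\nu,G}(S)$ of $S$ in $G$ is the set of vertices of $G$ which have at least $\nu n$ neighbours in $S$. The graph $G$ is a robust $(\nu,\tau)$-expander if $|RN_{\nu,G}(S)|\ge |S|+\nu n$ for every $S\subseteq V(G)$ with $\tau n\le |S|\le (1-\tau)n$. Perfect matchings are regarded as sets of edges. For integer-valued random variables $Y,Z$, the total variation distance is $d_{\rm TV}(Y,Z):=\frac12\sum_{k\in\mathbb{Z}}|\mathbb{P}[Y=k]-\mathbb{P}[Z=k]|$. *)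

theory Defs
  imports "HOL-Probability.Probability"
begin

text \<open>
  A finite simple graph is given by its vertex set \<open>V\<close> and its edge set \<open>E\<close>, a set of
  two-element subsets of \<open>V\<close>. An edge \<open>{v, u}\<close> of a simple graph has \<open>u \<noteq> v\<close>, so the
  neighbourhoods below contain no loops.
\<close>

definition simple_graph :: "'a set \<Rightarrow> 'a set set \<Rightarrow> bool" where
  "simple_graph V E \<longleftrightarrow> finite V \<and> (\<forall>e\<in>E. e \<subseteq> V \<and> card e = 2)"

definition neighbours :: "'a set set \<Rightarrow> 'a \<Rightarrow> 'a set" where
  "neighbours E v = {u. {v, u} \<in> E}"

definition regular_graph :: "'a set \<Rightarrow> 'a set set \<Rightarrow> nat \<Rightarrow> bool" where
  "regular_graph V E d \<longleftrightarrow> simple_graph V E \<and> (\<forall>v\<in>V. card (neighbours E v) = d)"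

text \<open>Both graphs have the same vertex set \<open>V\<close>.\<close>

definition spanning_subgraph :: "'a set \<Rightarrow> 'a set set \<Rightarrow> 'a set set \<Rightarrow> bool" where
  "spanning_subgraph V F E \<longleftrightarrow> simple_graph V F \<and> F \<subseteq> E"

definition robust_nbhd :: "real \<Rightarrow> 'a set \<Rightarrow> 'a set set \<Rightarrow> 'a set \<Rightarrow> 'a set" where
  "robust_nbhd \<nu> V E S =
     {v \<in> V. real (card (neighbours E v \<inter> S)) \<ge> \<nu> * real (card V)}"

definition robust_expander :: "real \<Rightarrow> real \<Rightarrow> 'a set \<Rightarrow> 'a set set \<Rightarrow> bool" where
  "robust_expander \<nu> \<tau> V E \<longleftrightarrow>
     (\<forall>S\<subseteq>V. \<tau> * real (card V) \<le> real (card S) \<and> real (card S) \<le> (1 - \<tau>) * real (card V) \<longrightarrow>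
        real (card (robust_nbhd \<nu> V E S)) \<ge> real (card S) + \<nu> * real (card V))"

definition perfect_matchings :: "'a set \<Rightarrow> 'a set set \<Rightarrow> 'a set set set" where
  "perfect_matchings V E = {M. M \<subseteq> E \<and> (\<forall>v\<in>V. \<exists>!e. e \<in> M \<and> v \<in> e)}"

text \<open>
  Total variation distance of two integer-valued random variables, as a function of their laws.
  The family of summands is absolutely summable, since both mass functions sum to one.
\<close>

definition d_TV :: "int pmf \<Rightarrow> int pmf \<Rightarrow> real" where
  "d_TV p q = 1 / 2 * (\<Sum>\<^sub>\<infinity>k\<in>UNIV. \<bar>pmf p k - pmf q k\<bar>)"

text \<open>
  The law of \<open>\<bar>M \<inter> F\<bar>\<close> for a uniformly random perfect matching \<open>M\<close> of the graph \<open>(V, E)\<close>.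
  The value of \<open>pmf_of_set {}\<close> is unspecified, so this is meaningful only if the graph has a
  perfect matching.
\<close>

definition matching_overlap_pmf :: "'a set \<Rightarrow> 'a set set \<Rightarrow> 'a set set \<Rightarrow> int pmf" where
  "matching_overlap_pmf V E F =
     map_pmf (\<lambda>M. int (card (M \<inter> F))) (pmf_of_set (perfect_matchings V E))"

end

theory Submission
  imports Defs "HOL-Real_Asymp.Real_Asymp"
begin

text \<open>
  Let \<open>H\<close> be \<open>E\<close> with \<open>F\<close> removed and let \<open>M\<close> be a perfect matching. The walk that alternates a step to a
  uniformly random \<open>H\<close>-neighbour with the step along \<open>M\<close> is doubly stochastic. By robust expansion a
  bounded number of its steps satisfies a Doeblin minorization, whatever \<open>M\<close> is, so after \<open>O(log n)\<close>
  steps it is at every vertex with probability \<open>(1 + o(1)) / n\<close>. As only few walks of this length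
  revisit a vertex or hit a small forbidden set, the alternating cycles through a given edge are
  counted up to a factor \<open>1 + O(n powr (-1/2))\<close>.

  Switching along alternating cycles which contain exactly one edge of \<open>F\<close> and otherwise only edges
  of \<open>H\<close> relates the numbers \<open>m k\<close> of perfect matchings with \<open>k\<close> edges in \<open>F\<close>: double counting gives
  \<open>k m k / m (k - 1) = (1 + O(n powr (-1/2))) r n / (2 d)\<close> for \<open>k \<le> n powr (1/10)\<close>. These are the
  ratios of the Poisson probabilities, and larger \<open>k\<close> are negligible by Markov's inequality, since
  switching in the whole graph bounds the mean overlap. The same switchings turn a perfect matching
  of the complete graph on \<open>V\<close> into one of \<open>E\<close>.
\<close>

subsection \<open>Alternating walks and their mixing\<close>

text \<open>One minorization constant serves all matchings because the partner map is a bijection: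
  it preserves the sizes of sets, and robust expansion speaks of sizes only.

  An alternating cycle with a single edge of \<open>F\<close> is obtained by avoiding all vertices
  covered by \<open>M \<inter> F\<close>. This is affordable only while the overlap is small, hence
  the cutoff at n powr (1/10). The exponents leave room: n powr (1/10) ratios with relative errors
  O(n powr (-1/2)) multiply to 1 + o(1), and a mean of O(n powr (1/50)) is negligible against the
  cutoff.

  The mean must be bounded before the overlap is known to be small; in the whole graph no vertex has
  to be avoided.

  The ratio r n / (2 d) comes out as follows. With D = d - r, a matching with k edges in
  \<open>F\<close> starts about 2 k D^(m+1) / n switches, one for each orientation and each path.
  About r n D^m / n end in a matching, one for each ordered edge of \<open>F\<close> and each path;
  here the two edges next to it are forced, so one choice is lost.\<close>

fun alt_walk :: "('a \<Rightarrow> 'a set) \<Rightarrow> ('a \<Rightarrow> 'a) \<Rightarrow> 'a \<Rightarrow> 'a \<Rightarrow> 'a list \<Rightarrow> bool" where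
  "alt_walk Nb p b a [] \<longleftrightarrow> b \<in> Nb a"
| "alt_walk Nb p b a (u # us) \<longleftrightarrow> u \<in> Nb a \<and> alt_walk Nb p b (p u) us"

text \<open>Only vertices entered by an \<open>Nb\<close>-step are listed, as their partners are
  determined. Testing \<open>u\<close> alone suffices when \<open>U\<close> is closed under
  \<open>p\<close>, for then \<open>p u\<close> lies outside \<open>U\<close> too. The end
  \<open>b\<close> is not tested: in the switchings it belongs to \<open>U\<close>, so that no
  earlier step can visit it.\<close>

fun alt_path :: "('a \<Rightarrow> 'a set) \<Rightarrow> ('a \<Rightarrow> 'a) \<Rightarrow> 'a \<Rightarrow> 'a set \<Rightarrow> 'a \<Rightarrow> 'a list \<Rightarrow> bool" where
  "alt_path Nb p b U a [] \<longleftrightarrow> b \<in> Nb a"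
| "alt_path Nb p b U a (u # us) \<longleftrightarrow>
     u \<in> Nb a \<and> u \<notin> U \<and> alt_path Nb p b (insert u (insert (p u) U)) (p u) us"

definition alt_walks :: "('a \<Rightarrow> 'a set) \<Rightarrow> ('a \<Rightarrow> 'a) \<Rightarrow> nat \<Rightarrow> 'a \<Rightarrow> 'a \<Rightarrow> 'a list set" where
  "alt_walks Nb p m a b = {us. length us = m \<and> alt_walk Nb p b a us}"

definition alt_paths :: "('a \<Rightarrow> 'a set) \<Rightarrow> ('a \<Rightarrow> 'a) \<Rightarrow> nat \<Rightarrow> 'a set \<Rightarrow> 'a \<Rightarrow> 'a \<Rightarrow> 'a list set" where
  "alt_paths Nb p m U a b = {us. length us = m \<and> alt_path Nb p b U a us}"

lemma alt_walks_0: "alt_walks Nb p 0 a b = (if b \<in> Nb a then {[]} else {})"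
  by (auto simp: alt_walks_def)

lemma alt_paths_0: "alt_paths Nb p 0 U a b = (if b \<in> Nb a then {[]} else {})"
  by (auto simp: alt_paths_def)

lemma alt_walks_Suc:
  "alt_walks Nb p (Suc m) a b =
     (\<lambda>(u, us). u # us) ` (SIGMA u : Nb a. alt_walks Nb p m (p u) b)"
proof (rule set_eqI)
  fix us show "us \<in> alt_walks Nb p (Suc m) a b \<longleftrightarrow> us \<in> (\<lambda>(u, us). u # us) `
      (SIGMA u : Nb a. alt_walks Nb p m (p u) b)"
    by (cases us) (auto simp: alt_walks_def image_iff)
qed

lemma alt_paths_Suc:
  "alt_paths Nb p (Suc m) U a b =
     (\<lambda>(u, us). u # us) `
       (SIGMA u : Nb a - U. alt_paths Nb p m (insert u (insert (p u) U)) (p u) b)"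
proof (rule set_eqI)
  fix us show "us \<in> alt_paths Nb p (Suc m) U a b \<longleftrightarrow> us \<in> (\<lambda>(u, us). u # us) `
      (SIGMA u : Nb a - U. alt_paths Nb p m (insert u (insert (p u) U)) (p u) b)"
    by (cases us) (auto simp: alt_paths_def image_iff)
qed

lemma alt_path_imp_alt_walk: "alt_path Nb p b U a us \<Longrightarrow> alt_walk Nb p b a us"
  by (induction us arbitrary: U a) auto

locale alternation =
  fixes V :: "'a set" and Nb :: "'a \<Rightarrow> 'a set" and D :: nat and p :: "'a \<Rightarrow> 'a"
  assumes finite_V: "finite V"
    and Nb_subset: "v \<in> V \<Longrightarrow> Nb v \<subseteq> V"
    and card_Nb: "v \<in> V \<Longrightarrow> card (Nb v) = D"
    and Nb_sym: "v \<in> V \<Longrightarrow> u \<in> Nb v \<Longrightarrow> v \<in> Nb u"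
    and D_pos: "D > 0"
    and p_in: "v \<in> V \<Longrightarrow> p v \<in> V"
    and p_p: "v \<in> V \<Longrightarrow> p (p v) = v"
begin

lemma finite_Nb: "v \<in> V \<Longrightarrow> finite (Nb v)"
  using Nb_subset finite_V finite_subset by blast

lemma p_Nb_in: "v \<in> V \<Longrightarrow> u \<in> Nb v \<Longrightarrow> p u \<in> V"
  using Nb_subset p_in by blast

lemma finite_alt_walks: "a \<in> V \<Longrightarrow> finite (alt_walks Nb p m a b)"
proof (induction m arbitrary: a)
  case 0
  then show ?case by (simp add: alt_walks_0)
next
  case (Suc m)
  then show ?case
    by (auto simp: alt_walks_Suc finite_Nb p_Nb_in intro!: finite_imageI finite_SigmaI)
qed

lemma alt_paths_subset: "alt_paths Nb p m U a b \<subseteq> alt_walks Nb p m a b"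
  by (auto simp: alt_paths_def alt_walks_def alt_path_imp_alt_walk)

lemma finite_alt_paths: "a \<in> V \<Longrightarrow> finite (alt_paths Nb p m U a b)"
  using finite_alt_walks alt_paths_subset finite_subset by metis

lemma card_alt_walks_Suc:
  assumes "a \<in> V"
  shows "card (alt_walks Nb p (Suc m) a b) = (\<Sum>u\<in>Nb a. card (alt_walks Nb p m (p u) b))"
  unfolding alt_walks_Suc using assms
  by (subst card_image) (auto simp: inj_on_def finite_Nb p_Nb_in finite_alt_walks)

lemma card_alt_paths_Suc:
  assumes "a \<in> V"
  shows "card (alt_paths Nb p (Suc m) U a b) =
    (\<Sum>u\<in>Nb a - U. card (alt_paths Nb p m (insert u (insert (p u) U)) (p u) b))"
  unfolding alt_paths_Suc using assms
  by (subst card_image) (auto simp: inj_on_def finite_Nb p_Nb_in finite_alt_paths)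

lemma card_alt_walks_le: "a \<in> V \<Longrightarrow> card (alt_walks Nb p m a b) \<le> D ^ m"
proof (induction m arbitrary: a)
  case 0
  then show ?case by (simp add: alt_walks_0)
next
  case (Suc m)
  have "card (alt_walks Nb p (Suc m) a b) \<le> (\<Sum>u\<in>Nb a. D ^ m)"
    unfolding card_alt_walks_Suc[OF Suc.prems]
    by (intro sum_mono Suc.IH) (use Suc.prems p_Nb_in in auto)
  then show ?case
    using card_Nb[OF Suc.prems] by simp
qed

text \<open>A walk that is not a path has a listed vertex in \<open>U\<close> or among the at most
  \<open>2 * m\<close> vertices collected before. That step has at most
  \<open>card U + 2 * m\<close> choices instead of \<open>D\<close>, and the last step to
  \<open>b\<close> is forced.\<close>

lemma card_alt_walks_le_card_alt_paths:
  assumes "a \<in> V" "finite U"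
  shows "card (alt_walks Nb p m a b) \<le>
    card (alt_paths Nb p m U a b) + m * (card U + 2 * m) * D ^ (m - 1)"
  using assms
proof (induction m arbitrary: a U)
  case 0
  then show ?case by (simp add: alt_walks_0 alt_paths_0)
next
  case (Suc m)
  let ?U = "\<lambda>u. insert u (insert (p u) U)"
  let ?w = "\<lambda>u. card (alt_walks Nb p m (p u) b)"
  let ?q = "\<lambda>u. card (alt_paths Nb p m (?U u) (p u) b)"
  let ?e = "m * (card U + 2 + 2 * m) * D ^ (m - 1)"
  have fin: "finite (Nb a)"
    using finite_Nb Suc.prems by blast
  have cU: "card (?U u) \<le> card U + 2" for u
    using card_insert_le_m1 Suc.prems(2) by (simp add: card_insert_if)
  have "(\<Sum>u\<in>Nb a \<inter> U. ?w u) \<le> (\<Sum>u\<in>Nb a \<inter> U. D ^ m)"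
    by (intro sum_mono card_alt_walks_le) (use Suc.prems p_Nb_in in auto)
  also have "\<dots> \<le> card U * D ^ m"
    using Suc.prems(2) by (simp add: card_mono)
  finally have 1: "(\<Sum>u\<in>Nb a \<inter> U. ?w u) \<le> card U * D ^ m" .
  \<comment> \<open>First steps outside \<open>U\<close>: the induction hypothesis for a forbidden
    set with up to two more elements.\<close>
  have "(\<Sum>u\<in>Nb a - U. ?w u) \<le> (\<Sum>u\<in>Nb a - U. ?q u + ?e)"
  proof (intro sum_mono)
    fix u assume "u \<in> Nb a - U"
    then have "?w u \<le> ?q u + m * (card (?U u) + 2 * m) * D ^ (m - 1)"
      using Suc.prems p_Nb_in by (intro Suc.IH) auto
    also have "\<dots> \<le> ?q u + ?e"
      using cU[of u] by (intro add_left_mono mult_right_mono mult_left_mono) auto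
    finally show "?w u \<le> ?q u + ?e" .
  qed
  also have "\<dots> = card (alt_paths Nb p (Suc m) U a b) + card (Nb a - U) * ?e"
    unfolding card_alt_paths_Suc[OF Suc.prems(1)] by (simp add: sum.distrib)
  also have "card (Nb a - U) * ?e \<le> D * ?e"
    using card_Nb[OF Suc.prems(1)] fin by (metis Diff_subset card_mono mult_le_mono1)
  also have "D * ?e = m * (card U + 2 + 2 * m) * D ^ m"
  proof (cases "m = 0")
    case False
    have "D * ?e = m * (card U + 2 + 2 * m) * (D ^ (m - 1) * D)"
      by (simp only: mult_ac)
    then show ?thesis
      using False by (simp only: power_minus_mult)
  qed simp
  finally have 2: "(\<Sum>u\<in>Nb a - U. ?w u) \<le>
      card (alt_paths Nb p (Suc m) U a b) + m * (card U + 2 + 2 * m) * D ^ m"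
    by simp
  have "card (alt_walks Nb p (Suc m) a b) = (\<Sum>u\<in>Nb a \<inter> U. ?w u) + (\<Sum>u\<in>Nb a - U. ?w u)"
    unfolding card_alt_walks_Suc[OF Suc.prems(1)] using fin by (rule sum.Int_Diff)
  also have "\<dots> \<le> card (alt_paths Nb p (Suc m) U a b)
      + (card U + m * (card U + 2 + 2 * m)) * D ^ m"
    using 1 2 by (simp add: algebra_simps)
  also have "\<dots> \<le> card (alt_paths Nb p (Suc m) U a b) + (Suc m * (card U + 2 * Suc m)) * D ^ m"
    by (intro add_left_mono mult_right_mono) auto
  finally show ?case by simp
qed

section \<open>The Markov operator of the walk and its adjoint\<close>

definition avg :: "('a \<Rightarrow> real) \<Rightarrow> 'a \<Rightarrow> real" where
  "avg f a = (\<Sum>u\<in>Nb a. f (p u)) / D"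

text \<open>The adjoint of \<open>avg\<close>, which moves mass forward by one step. Mass arriving
  at \<open>x\<close> has come along the matching edge from \<open>p x\<close>, hence from the
  neighbours of \<open>p x\<close>.\<close>

definition push :: "('a \<Rightarrow> real) \<Rightarrow> 'a \<Rightarrow> real" where
  "push k x = (\<Sum>v\<in>Nb (p x). k v) / D"

lemma sum_p: "(\<Sum>x\<in>V. h (p x)) = sum h V"
  by (rule sum.reindex_bij_witness[of _ p p]) (auto simp: p_in p_p)

lemma push_duality: "(\<Sum>a\<in>V. k a * avg f a) = (\<Sum>x\<in>V. push k x * f x)"
proof -
  have set1: "{u \<in> V. u \<in> Nb a} = Nb a" if "a \<in> V" for a
    using Nb_subset that by blast
  have set2: "{a \<in> V. u \<in> Nb a} = Nb u" if "u \<in> V" for u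
    using Nb_subset Nb_sym that by blast
  have "(\<Sum>a\<in>V. \<Sum>u\<in>Nb a. k a * f (p u)) = (\<Sum>u\<in>V. \<Sum>a\<in>Nb u. k a * f (p u))"
    using sum.swap_restrict[OF finite_V finite_V, of "\<lambda>a u. k a * f (p u)" "\<lambda>a u. u \<in> Nb a"]
    by (simp add: set1 set2)
  also have "\<dots> = (\<Sum>x\<in>V. \<Sum>a\<in>Nb (p x). k a * f x)"
    using sum_p[of "\<lambda>u. \<Sum>a\<in>Nb u. k a * f (p u)"] by (simp add: p_p)
  finally show ?thesis
    by (simp add: avg_def push_def sum_distrib_left sum_distrib_right flip: sum_divide_distrib)
qed

lemma avg_cong: "a \<in> V \<Longrightarrow> (\<And>x. x \<in> V \<Longrightarrow> f x = g x) \<Longrightarrow> avg f a = avg g a"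
  unfolding avg_def using p_Nb_in by (auto intro!: sum.cong)

lemma avg_const: "a \<in> V \<Longrightarrow> avg (\<lambda>_. c) a = c"
  using D_pos by (simp add: avg_def card_Nb)

lemma avg_pow_const: "a \<in> V \<Longrightarrow> (avg ^^ t) (\<lambda>_. c) a = c"
proof (induction t arbitrary: a)
  case (Suc t)
  have "avg ((avg ^^ t) (\<lambda>_. c)) a = avg (\<lambda>_. c) a"
    by (rule avg_cong) (use Suc in auto)
  then show ?case
    using Suc.prems by (simp add: avg_const)
qed simp

text \<open>The column sums of the transition matrix are 1 because \<open>p x\<close> has exactly
  \<open>D\<close> neighbours; so the uniform distribution is invariant.\<close>

lemma push_const: "x \<in> V \<Longrightarrow> push (\<lambda>_. c) x = c"
  using D_pos by (simp add: push_def card_Nb p_in)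

lemma sum_avg: "(\<Sum>a\<in>V. avg f a) = sum f V"
  using push_duality[of "\<lambda>_. 1" f] by (simp add: push_const)

lemma sum_avg_pow: "(\<Sum>a\<in>V. (avg ^^ t) f a) = sum f V"
  by (induction t) (auto simp: sum_avg)

lemma push_pow_duality: "(\<Sum>a\<in>V. k a * (avg ^^ t) f a) = (\<Sum>x\<in>V. (push ^^ t) k x * f x)"
proof (induction t arbitrary: f)
  case (Suc t)
  have "(\<Sum>a\<in>V. k a * (avg ^^ Suc t) f a) = (\<Sum>a\<in>V. k a * (avg ^^ t) (avg f) a)"
    by (simp only: funpow_Suc_right o_apply)
  then show ?case
    by (simp add: Suc push_duality)
qed simp

definition dirac :: "'a \<Rightarrow> 'a \<Rightarrow> real" where
  "dirac a x = (if x = a then 1 else 0)"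

text \<open>Identifies \<open>(push ^^ t) (dirac a)\<close> as the law of the walk from
  \<open>a\<close> after \<open>t\<close> steps, the kernel to which Doeblin's argument
  applies.\<close>

lemma avg_pow_eq: "a \<in> V \<Longrightarrow> (avg ^^ t) f a = (\<Sum>x\<in>V. (push ^^ t) (dirac a) x * f x)"
proof -
  assume a: "a \<in> V"
  have "(\<Sum>x\<in>V. dirac a x * (avg ^^ t) f x) = (\<Sum>x\<in>V. if x = a then (avg ^^ t) f x else 0)"
    by (intro sum.cong) (auto simp: dirac_def)
  then show ?thesis
    using a finite_V push_pow_duality[of "dirac a" t f] by simp
qed

text \<open>Subtracting \<open>c / card V\<close> from every entry leaves a nonnegative kernel of
  mass \<open>1 - c\<close>, while the constant part subtracted annihilates
  \<open>f - \<mu>\<close>, whose sum is zero.\<close>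

lemma doeblin_contraction:
  fixes f :: "'a \<Rightarrow> real" and c \<mu> B :: real
  assumes minor: "\<And>x. x \<in> V \<Longrightarrow> (push ^^ t) (dirac a) x \<ge> c / card V"
    and "a \<in> V"
    and sumf: "sum f V = card V * \<mu>"
    and B: "\<And>x. x \<in> V \<Longrightarrow> \<bar>f x - \<mu>\<bar> \<le> B"
  shows "\<bar>(avg ^^ t) f a - \<mu>\<bar> \<le> (1 - c) * B"
proof -
  let ?K = "(push ^^ t) (dirac a)"
  have cV: "card V > 0"
    using assms(2) finite_V card_gt_0_iff by blast
  have K1: "sum ?K V = 1"
    using avg_pow_eq[OF assms(2), of t "\<lambda>_. 1"] avg_pow_const[OF assms(2)] by simp
  have "(avg ^^ t) f a - \<mu> = (\<Sum>x\<in>V. ?K x * f x) - \<mu> * sum ?K V"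
    using avg_pow_eq[OF assms(2)] K1 by simp
  also have "\<dots> = (\<Sum>x\<in>V. ?K x * (f x - \<mu>))"
    by (simp add: algebra_simps sum_subtractf sum_distrib_left)
  also have "\<dots> = (\<Sum>x\<in>V. (?K x - c / card V) * (f x - \<mu>)) + (c / card V) * (\<Sum>x\<in>V. f x - \<mu>)"
    by (simp add: sum_distrib_left flip: sum.distrib) (simp add: algebra_simps)
  also have "(\<Sum>x\<in>V. f x - \<mu>) = 0"
    using sumf by (simp add: sum_subtractf)
  finally have "\<bar>(avg ^^ t) f a - \<mu>\<bar> \<le> (\<Sum>x\<in>V. \<bar>(?K x - c / card V) * (f x - \<mu>)\<bar>)"
    by simp
  also have "\<dots> \<le> (\<Sum>x\<in>V. (?K x - c / card V) * B)"
  proof (intro sum_mono)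
    fix x assume "x \<in> V"
    then show "\<bar>(?K x - c / card V) * (f x - \<mu>)\<bar> \<le> (?K x - c / card V) * B"
      using minor[of x] B[of x] by (auto simp: abs_mult intro!: mult_left_mono)
  qed
  also have "\<dots> = (1 - c) * B"
    using K1 cV by (simp add: sum_subtractf flip: sum_distrib_right)
  finally show ?thesis .
qed

text \<open>Averaging cannot increase the deviation; this covers lengths that are not multiples of
  \<open>mix_time\<close>.\<close>

lemma avg_mono_dist:
  fixes \<mu> B :: real
  assumes "a \<in> V" "\<And>x. x \<in> V \<Longrightarrow> \<bar>f x - \<mu>\<bar> \<le> B"
  shows "\<bar>avg f a - \<mu>\<bar> \<le> B"
proof -
  have "avg f a - \<mu> = avg f a - avg (\<lambda>_. \<mu>) a"
    using assms by (simp add: avg_const)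
  also have "\<dots> = (\<Sum>u\<in>Nb a. f (p u) - \<mu>) / D"
    by (simp add: avg_def sum_subtractf diff_divide_distrib)
  finally have "\<bar>avg f a - \<mu>\<bar> = \<bar>\<Sum>u\<in>Nb a. f (p u) - \<mu>\<bar> / D"
    by simp
  also have "\<dots> \<le> (\<Sum>u\<in>Nb a. B) / D"
    by (intro divide_right_mono order.trans[OF sum_abs] sum_mono assms)
       (use assms p_Nb_in in auto)
  also have "\<dots> = B"
    using D_pos assms by (simp add: card_Nb)
  finally show ?thesis .
qed

lemma push_ge:
  fixes q :: real
  assumes "\<And>x. x \<in> V \<Longrightarrow> k x \<ge> 0" "A \<subseteq> V" "\<And>x. x \<in> A \<Longrightarrow> k x \<ge> q" "x \<in> V"
  shows "push k x \<ge> card (Nb (p x) \<inter> A) * q / D"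
proof -
  have "card (Nb (p x) \<inter> A) * q = (\<Sum>v\<in>Nb (p x) \<inter> A. q)"
    by simp
  also have "\<dots> \<le> (\<Sum>v\<in>Nb (p x) \<inter> A. k v)"
    by (intro sum_mono) (use assms in auto)
  also have "\<dots> \<le> (\<Sum>v\<in>Nb (p x). k v)"
    using assms finite_Nb p_in Nb_subset[OF p_in[OF assms(4)]] by (intro sum_mono2) auto
  finally show ?thesis
    unfolding push_def by (simp add: divide_right_mono)
qed

lemma push_pow_nonneg: "x \<in> V \<Longrightarrow> (push ^^ t) (dirac a) x \<ge> 0"
proof (induction t arbitrary: x)
  case 0
  then show ?case by (simp add: dirac_def)
next
  case (Suc t)
  then show ?case
    using Nb_subset p_in by (auto simp: push_def intro!: divide_nonneg_nonneg sum_nonneg)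
qed

lemma D_le_card: "a \<in> V \<Longrightarrow> D \<le> card V"
  using card_Nb Nb_subset finite_V card_mono by metis

end

section \<open>Doeblin minorization from robust expansion\<close>

locale expanding_alternation = alternation +
  fixes \<kappa> \<tau> :: real
  assumes \<kappa>_pos: "\<kappa> > 0" and D_ge: "real D \<ge> 2 * \<tau> * card V"
    and expansion: "S \<subseteq> V \<Longrightarrow> \<tau> * card V \<le> card S \<Longrightarrow> card S \<le> (1 - \<tau>) * card V \<Longrightarrow>
      card {v \<in> V. card (Nb v \<inter> S) \<ge> \<kappa> * card V} \<ge> card S + \<kappa> * card V"
begin

text \<open>The heavy set grows by \<open>\<kappa> n\<close> in each step until it exceeds \<open>(1 - \<tau>) n\<close>; then every vertex
  has at least half of its neighbours in it, so after one more step it is all of \<open>V\<close>. This takes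
  a number of steps depending on \<open>\<kappa>\<close> only.\<close>

definition heavy :: "'a \<Rightarrow> nat \<Rightarrow> 'a set" where
  "heavy a t = {x \<in> V. (push ^^ Suc t) (dirac a) x \<ge> (min \<kappa> (1 / 2)) ^ t / card V}"

lemma heavy_subset: "heavy a t \<subseteq> V"
  by (auto simp: heavy_def)

lemma finite_heavy: "finite (heavy a t)"
  using heavy_subset finite_V finite_subset by metis

text \<open>Each heavy neighbour of \<open>p x\<close> hands on a \<open>1 / D\<close> share of its
  mass. The factor \<open>min \<kappa> (1 / 2)\<close> covers both regimes: while the set grows, the
  heavy fraction of the neighbours is at least \<open>\<kappa>\<close>; in the filling step it is at
  least one half.\<close>

lemma heavy_step:
  assumes "a \<in> V" "x \<in> V" "card (Nb (p x) \<inter> heavy a t) \<ge> min \<kappa> (1 / 2) * D"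
  shows "x \<in> heavy a (Suc t)"
proof -
  let ?c = "min \<kappa> (1 / 2)"
  have c0: "?c > 0" using \<kappa>_pos by simp
  have "?c ^ Suc t / card V = ?c * D * (?c ^ t / card V) / D"
    using D_pos by simp
  also have "\<dots> \<le> card (Nb (p x) \<inter> heavy a t) * (?c ^ t / card V) / D"
    using assms(3) c0 by (intro divide_right_mono mult_right_mono) auto
  also have "\<dots> \<le> push ((push ^^ Suc t) (dirac a)) x"
    by (rule push_ge[OF push_pow_nonneg heavy_subset _ assms(2)]) (auto simp: heavy_def)
  finally show ?thesis
    using assms(2) by (simp add: heavy_def)
qed

lemma heavy_full:
  assumes "a \<in> V" "card (heavy a t) > (1 - \<tau>) * card V"
  shows "heavy a (Suc t) = V"
proof -
  have "x \<in> heavy a (Suc t)" if x: "x \<in> V" for x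
  proof (rule heavy_step[OF assms(1) x])
    let ?N = "Nb (p x)"
    have "D = card (?N \<inter> heavy a t) + card (?N - heavy a t)"
      using card_Int_Diff[of ?N "heavy a t"] finite_Nb card_Nb x p_in by simp
    moreover have "card (?N - heavy a t) \<le> card (V - heavy a t)"
      using Nb_subset x p_in finite_V by (intro card_mono) auto
    moreover have "card (V - heavy a t) = card V - card (heavy a t)"
      using finite_heavy heavy_subset by (simp add: card_Diff_subset)
    moreover have "card (heavy a t) \<le> card V"
      using heavy_subset finite_V by (simp add: card_mono)
    ultimately have "real D \<le> card (?N \<inter> heavy a t) + (real (card V) - card (heavy a t))"
      by linarith
    then have "real D \<le> card (?N \<inter> heavy a t) + \<tau> * card V"
      using assms(2) by (simp add: algebra_simps)
    \<comment> \<open>At most \<open>\<tau> * card V\<close> neighbours are not heavy, and by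
      \<open>D_ge\<close> this is at most half of the degree.\<close>
    then have "card (?N \<inter> heavy a t) \<ge> 1 / 2 * real D"
      using D_ge by linarith
    moreover have "min \<kappa> (1 / 2) * real D \<le> 1 / 2 * real D"
      by (intro mult_right_mono) auto
    ultimately show "card (?N \<inter> heavy a t) \<ge> min \<kappa> (1 / 2) * D"
      by linarith
  qed
  then show ?thesis using heavy_subset by blast
qed

lemma heavy_growth:
  assumes a: "a \<in> V"
  shows "card (heavy a t) \<ge> \<tau> * card V \<and>
    (card (heavy a t) \<ge> t * \<kappa> * card V \<or> card (heavy a t) > (1 - \<tau>) * card V)"
proof (induction t)
  case 0
  have "p ` Nb a \<subseteq> heavy a 0"
  proof
    fix x assume "x \<in> p ` Nb a"
    then obtain u where u: "u \<in> Nb a" "x = p u" by blast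
    then have "u \<in> V" using Nb_subset a by blast
    have "1 / card V \<le> 1 / real D"
      using D_le_card[OF a] D_pos by (intro divide_left_mono) auto
    also have "\<dots> = push (dirac a) x"
      using u \<open>u \<in> V\<close> finite_Nb Nb_sym a
      by (simp add: push_def p_p dirac_def sum.delta)
    finally show "x \<in> heavy a 0"
      using u p_in \<open>u \<in> V\<close> by (simp add: heavy_def)
  qed
  moreover have "card (p ` Nb a) = D"
    by (subst card_image) (use card_Nb a p_p Nb_subset in \<open>auto intro!: inj_on_inverseI[of _ p]\<close>)
  ultimately have "D \<le> card (heavy a 0)"
    using finite_heavy card_mono by metis
  then show ?case
    using D_ge D_pos by auto
next
  case (Suc t)
  have V: "\<tau> * card V \<le> card V"
  proof -
    have "2 * \<tau> * card V \<le> card V"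
      using D_ge D_le_card[OF a] by linarith
    then show ?thesis by linarith
  qed
  show ?case
  proof (cases "card (heavy a t) > (1 - \<tau>) * card V")
    case True
    then have *: "heavy a (Suc t) = V" by (rule heavy_full[OF a])
    have "card (heavy a t) \<le> card V"
      using heavy_subset finite_V by (simp add: card_mono)
    then show ?thesis
      using V True * by auto
  next
    case False
    define R where "R = {v \<in> V. card (Nb v \<inter> heavy a t) \<ge> \<kappa> * card V}"
    have R: "card R \<ge> card (heavy a t) + \<kappa> * card V"
      unfolding R_def using Suc False heavy_subset by (intro expansion) auto
    have "p ` R \<subseteq> heavy a (Suc t)"
    proof safe
      fix v assume v: "v \<in> R"
      show "p v \<in> heavy a (Suc t)"
      proof (rule heavy_step[OF a])
        show "p v \<in> V" using v p_in by (auto simp: R_def)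
        have "min \<kappa> (1 / 2) * D \<le> \<kappa> * card V"
          using D_le_card[OF a] \<kappa>_pos by (intro mult_mono) auto
        also have "\<dots> \<le> card (Nb v \<inter> heavy a t)"
          using v by (simp add: R_def)
        finally show "card (Nb (p (p v)) \<inter> heavy a t) \<ge> min \<kappa> (1 / 2) * D"
          using v by (simp add: R_def p_p)
      qed
    qed
    moreover have "card (p ` R) = card R"
      by (intro card_image inj_on_inverseI[of _ p]) (auto simp: R_def p_p)
    ultimately have "card R \<le> card (heavy a (Suc t))"
      using finite_heavy card_mono by metis
    then have "card (heavy a t) + \<kappa> * card V \<le> card (heavy a (Suc t))"
      using R by linarith
    moreover have "\<kappa> * card V \<ge> 0" using \<kappa>_pos by simp
    ultimately show ?thesis
      using Suc False by (auto simp: algebra_simps)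
  qed
qed

end

text \<open>At most \<open>nat \<lceil>1 / \<kappa>\<rceil>\<close> rounds of growth, one round to
  fill \<open>V\<close>, and one more because \<open>heavy a t\<close> refers to the law after
  \<open>Suc t\<close> steps.\<close>

definition mix_time :: "real \<Rightarrow> nat" where
  "mix_time \<kappa> = nat \<lceil>1 / \<kappa>\<rceil> + 2"

definition mix_rate :: "real \<Rightarrow> real" where
  "mix_rate \<kappa> = (min \<kappa> (1 / 2)) ^ (nat \<lceil>1 / \<kappa>\<rceil> + 1)"

lemma mix_rate_bounds: "\<kappa> > 0 \<Longrightarrow> mix_rate \<kappa> > 0 \<and> mix_rate \<kappa> < 1"
  unfolding mix_rate_def Suc_eq_plus1[symmetric] by (intro conjI zero_less_power power_Suc_less_one) auto

context expanding_alternation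
begin

lemma minorization:
  assumes a: "a \<in> V" and x: "x \<in> V"
  shows "(push ^^ mix_time \<kappa>) (dirac a) x \<ge> mix_rate \<kappa> / card V"
proof -
  define t where "t = nat \<lceil>1 / \<kappa>\<rceil>"
  have "real t \<ge> 1 / \<kappa>"
    unfolding t_def by linarith
  then have t: "t * \<kappa> \<ge> 1"
    using \<kappa>_pos by (simp add: field_simps)
  have cV: "real (card V) > 0"
    using a finite_V card_gt_0_iff by auto
  have "heavy a (Suc t) = V"
  proof (cases "card (heavy a t) > (1 - \<tau>) * card V")
    case True
    then show ?thesis by (rule heavy_full[OF a])
  next
    case False
    \<comment> \<open>As \<open>\<tau>\<close> may be nonpositive here, the heavy set can be all of
      \<open>V\<close> without exceeding the threshold.\<close>
    then have "card (heavy a t) \<ge> t * \<kappa> * card V"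
      using heavy_growth[OF a] by blast
    moreover have "t * \<kappa> * card V \<ge> 1 * real (card V)"
      using t cV by (intro mult_right_mono) auto
    ultimately have full: "card (heavy a t) \<ge> real (card V)" by linarith
    then have "heavy a t = V"
      using heavy_subset finite_V card_seteq by (metis of_nat_le_iff)
    have "x \<in> heavy a (Suc t)" if "x \<in> V" for x
    proof (rule heavy_step[OF a that])
      show "min \<kappa> (1 / 2) * D \<le> card (Nb (p x) \<inter> heavy a t)"
        using \<open>heavy a t = V\<close> Nb_subset[OF p_in[OF that]] card_Nb[OF p_in[OF that]]
          mult_right_mono[of "min \<kappa> (1 / 2)" 1 "real D"]
        by (simp add: Int_absorb2)
    qed
    then show ?thesis using heavy_subset by blast
  qed
  then show ?thesis
    using x by (auto simp: heavy_def t_def mix_time_def mix_rate_def)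
qed

text \<open>The probability that \<open>m\<close> full steps from \<open>a\<close> and one more
  \<open>Nb\<close>-step lead to \<open>b\<close>. For fixed \<open>b\<close> it is a function of
  the start, to which \<open>avg\<close> applies; its values sum to 1, so \<open>1 / card V\<close>
  is its mean.\<close>

definition walk_density :: "'a \<Rightarrow> nat \<Rightarrow> 'a \<Rightarrow> real" where
  "walk_density b m a = card (alt_walks Nb p m a b) / D ^ (m + 1)"

lemma walk_density_Suc: "a \<in> V \<Longrightarrow> walk_density b (Suc m) a = avg (walk_density b m) a"
  by (simp add: walk_density_def avg_def card_alt_walks_Suc sum_divide_distrib[symmetric] mult.commute)

lemma walk_density_add:
  "a \<in> V \<Longrightarrow> walk_density b (t + m) a = (avg ^^ t) (walk_density b m) a"
proof (induction t arbitrary: a)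
  case (Suc t)
  have "avg (walk_density b (t + m)) a = avg ((avg ^^ t) (walk_density b m)) a"
    by (rule avg_cong[OF Suc.prems Suc.IH])
  then show ?case
    using walk_density_Suc[OF Suc.prems, of b "t + m"] by simp
qed simp

lemma sum_walk_density:
  assumes b: "b \<in> V"
  shows "sum (walk_density b m) V = 1"
proof -
  have "sum (walk_density b m) V = (\<Sum>a\<in>V. (avg ^^ m) (walk_density b 0) a)"
    using walk_density_add[of _ b m 0] by simp
  also have "\<dots> = sum (walk_density b 0) V"
    by (rule sum_avg_pow)
  also have "\<dots> = (\<Sum>a\<in>V. if a \<in> Nb b then 1 / D else 0)"
    using Nb_sym b Nb_subset
    by (intro sum.cong) (auto simp: walk_density_def alt_walks_0)
  also have "\<dots> = (\<Sum>a\<in>Nb b. 1 / D)"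
    using finite_V Nb_subset[OF b]
    by (simp add: sum.If_cases Int_absorb1)
  also have "\<dots> = 1"
    using D_pos card_Nb b by simp
  finally show ?thesis .
qed

text \<open>Every block of \<open>mix_time\<close> steps contracts the deviation from the mean, and
  the remaining steps do not increase it.\<close>

lemma walk_density_mixing:
  assumes b: "b \<in> V" and a: "a \<in> V" and m: "m \<ge> mix_time \<kappa> * j"
  shows "\<bar>walk_density b m a - 1 / card V\<bar> \<le> (1 - mix_rate \<kappa>) ^ j"
proof -
  have cV: "real (card V) > 0"
    using a finite_V card_gt_0_iff by auto
  have base: "\<bar>walk_density b (mix_time \<kappa> * j) x - 1 / card V\<bar> \<le> (1 - mix_rate \<kappa>) ^ j"
    if "x \<in> V" for x
    using that
  proof (induction j arbitrary: x)
    case 0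
    have "0 \<le> walk_density b 0 x" "walk_density b 0 x \<le> 1"
      using D_pos by (auto simp: walk_density_def alt_walks_0)
    moreover have "0 \<le> 1 / real (card V)" "1 / real (card V) \<le> 1"
      using cV by auto
    ultimately have "\<bar>walk_density b 0 x - 1 / card V\<bar> \<le> 1" by linarith
    then show ?case by simp
  next
    case (Suc j)
    have "\<bar>(avg ^^ mix_time \<kappa>) (walk_density b (mix_time \<kappa> * j)) x - 1 / card V\<bar>
        \<le> (1 - mix_rate \<kappa>) * (1 - mix_rate \<kappa>) ^ j"
    proof (rule doeblin_contraction)
      show "sum (walk_density b (mix_time \<kappa> * j)) V = card V * (1 / card V)"
        using sum_walk_density[OF b] cV by simp
      show "mix_rate \<kappa> / card V \<le> (push ^^ mix_time \<kappa>) (dirac x) y" if "y \<in> V" for y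
        using that by (rule minorization[OF Suc.prems])
    qed (rule Suc)+
    then show ?case
      unfolding mult_Suc_right walk_density_add[OF Suc.prems] power_Suc .
  qed
  have "\<bar>walk_density b (i + mix_time \<kappa> * j) x - 1 / card V\<bar> \<le> (1 - mix_rate \<kappa>) ^ j"
    if "x \<in> V" for i x
    using that
  proof (induction i arbitrary: x)
    case 0
    then show ?case using base by simp
  next
    case (Suc i)
    have "\<bar>avg (walk_density b (i + mix_time \<kappa> * j)) x - 1 / card V\<bar> \<le> (1 - mix_rate \<kappa>) ^ j"
      by (rule avg_mono_dist[OF Suc.prems Suc.IH])
    then show ?case
      by (simp only: add_Suc walk_density_Suc[OF Suc.prems])
  qed
  from this[OF a, of "m - mix_time \<kappa> * j"] m show ?thesis by simp
qed

end

section \<open>Counting walks and paths of logarithmic length\<close>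

definition walk_length :: "real \<Rightarrow> nat \<Rightarrow> nat" where
  "walk_length \<kappa> n = mix_time \<kappa> * nat \<lceil>2 * ln (real n) / mix_rate \<kappa>\<rceil>"

text \<open>The relative error of the path count: \<open>1 / n\<close> from mixing, and the walks
  with a forbidden visit, at most \<open>l * (u + 2 * l) * D ^ (m - 1)\<close>, compared with
  \<open>D ^ (m + 1) / n\<close> for \<open>D \<ge> \<delta> * n\<close>. Here \<open>l\<close>
  bounds \<open>walk_length \<kappa> n + 1\<close> free of rounding, and \<open>u\<close> bounds the
  size of the forbidden set.\<close>

definition path_error :: "real \<Rightarrow> real \<Rightarrow> nat \<Rightarrow> real \<Rightarrow> real" where
  "path_error \<delta> \<kappa> n u = (let l = mix_time \<kappa> * (2 * ln (real n) / mix_rate \<kappa> + 1) + 1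
     in 1 / n + l * (u + 2 * l) / (\<delta>\<^sup>2 * n))"

text \<open>The error is n powr (-9/10) up to a logarithmic factor. The forbidden set consists of
  two ends, their partners and the vertices of at most n powr (1/10) matching edges.\<close>

lemma path_error_small:
  assumes "\<delta> > 0" "\<kappa> > 0"
  shows "eventually (\<lambda>n. path_error \<delta> \<kappa> n (4 + 2 * real n powr (1 / 10)) \<le> real n powr (-1/2)) at_top"
proof -
  have c: "mix_rate \<kappa> > 0" using mix_rate_bounds assms by blast
  have t: "real (mix_time \<kappa>) > 0" by (simp add: mix_time_def)
  define T where "T = real (mix_time \<kappa>)"
  define c where "c = mix_rate \<kappa>"
  have "T > 0" "c > 0" using c t by (simp_all add: T_def c_def)
  then show ?thesis
    unfolding path_error_def Let_def T_def[symmetric] c_def[symmetric]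
    using assms(1) by real_asymp
qed

context expanding_alternation
begin

lemma card_alt_walks_bounds:
  assumes ab: "a \<in> V" "b \<in> V" and m: "m \<ge> walk_length \<kappa> (card V)"
  shows "\<bar>card (alt_walks Nb p m a b) - D ^ (m + 1) / card V\<bar> \<le> D ^ (m + 1) / (card V)\<^sup>2"
proof -
  let ?n = "real (card V)" and ?c = "mix_rate \<kappa>"
  let ?j = "nat \<lceil>2 * ln ?n / ?c\<rceil>"
  have n: "?n \<ge> 1"
    using ab finite_V card_gt_0_iff by (metis empty_iff of_nat_1 of_nat_mono Suc_leI One_nat_def)
  have c: "?c > 0" "?c < 1" using mix_rate_bounds \<kappa>_pos by auto
  have "2 * ln ?n / ?c \<le> ?j" by linarith
  then have j: "2 * ln ?n \<le> ?c * ?j" using c by (simp add: field_simps)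
  \<comment> \<open>The number of blocks is chosen so that the deviation is at most
    \<open>1 / n ^ 2\<close>, a relative error of \<open>1 / n\<close> for a density of
    \<open>1 / n\<close>.\<close>
  have "(1 - ?c) ^ ?j \<le> exp (- ?c) ^ ?j"
    using c exp_ge_add_one_self[of "- ?c"] by (intro power_mono) auto
  also have "\<dots> = exp (- (?c * ?j))"
    by (simp add: exp_of_nat_mult[symmetric] mult.commute)
  also have "\<dots> \<le> exp (- (2 * ln ?n))" using j by simp
  also have "\<dots> = 1 / ?n\<^sup>2"
    using n by (simp add: exp_minus exp_double inverse_eq_divide)
  finally have "(1 - ?c) ^ ?j \<le> 1 / ?n\<^sup>2" .
  then have *: "\<bar>walk_density b m a - 1 / ?n\<bar> \<le> 1 / ?n\<^sup>2"
    using walk_density_mixing[OF ab(2,1), of ?j m] m by (simp add: walk_length_def)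
  have D: "real D ^ (m + 1) > 0" using D_pos by simp
  have "card (alt_walks Nb p m a b) - D ^ (m + 1) / ?n = D ^ (m + 1) * (walk_density b m a - 1 / ?n)"
    using D_pos by (simp add: walk_density_def algebra_simps)
  then have "\<bar>card (alt_walks Nb p m a b) - D ^ (m + 1) / ?n\<bar>
      = D ^ (m + 1) * \<bar>walk_density b m a - 1 / ?n\<bar>"
    by (simp add: abs_mult)
  also have "\<dots> \<le> D ^ (m + 1) * (1 / ?n\<^sup>2)"
    using D * by (intro mult_left_mono) auto
  finally show ?thesis by simp
qed

lemma card_alt_walks_upper:
  assumes "a \<in> V" "b \<in> V" "m \<ge> walk_length \<kappa> (card V)" "1 / card V \<le> \<epsilon>"
  shows "card (alt_walks Nb p m a b) \<le> (1 + \<epsilon>) * (D ^ (m + 1) / card V)"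
proof -
  have "D ^ (m + 1) / (card V)\<^sup>2 = (1 / card V) * (D ^ (m + 1) / card V)"
    by (simp add: power2_eq_square)
  also have "\<dots> \<le> \<epsilon> * (D ^ (m + 1) / card V)"
    using assms(4) by (intro mult_right_mono) auto
  finally show ?thesis
    using card_alt_walks_bounds[OF assms(1-3)] unfolding distrib_right by linarith
qed

text \<open>The length is bounded above as well, because the loss from revisits grows with it. Two
  consecutive lengths are allowed since the path of a switch is one step shorter when seen from the
  new matching.\<close>

lemma card_alt_paths_lower:
  fixes \<delta> \<epsilon> u :: real
  assumes ab: "a \<in> V" "b \<in> V" and m: "m \<ge> walk_length \<kappa> (card V)"
      "m \<le> walk_length \<kappa> (card V) + 1"
    and U: "finite U" "card U \<le> u" and \<delta>: "\<delta> > 0" "D \<ge> \<delta> * card V"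
    and \<epsilon>: "path_error \<delta> \<kappa> (card V) u \<le> \<epsilon>"
  shows "card (alt_paths Nb p m U a b) \<ge> (1 - \<epsilon>) * (D ^ (m + 1) / card V)"
proof -
  let ?n = "real (card V)" and ?c = "mix_rate \<kappa>"
  define l where "l = mix_time \<kappa> * (2 * ln ?n / ?c + 1) + 1"
  have n: "?n \<ge> 1"
    using ab finite_V card_gt_0_iff by (metis empty_iff of_nat_1 of_nat_mono Suc_leI One_nat_def)
  have c: "?c > 0" using mix_rate_bounds \<kappa>_pos by auto
  have "0 \<le> 2 * ln ?n / ?c" using c n by simp
  then have "real (nat \<lceil>2 * ln ?n / ?c\<rceil>) \<le> 2 * ln ?n / ?c + 1" by linarith
  then have "walk_length \<kappa> (card V) \<le> mix_time \<kappa> * (2 * ln ?n / ?c + 1)"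
    unfolding walk_length_def of_nat_mult by (intro mult_left_mono) auto
  then have ml: "m \<le> l" using m(2) by (simp add: l_def)
  have D2: "D ^ (m + 1) = D ^ 2 * D ^ (m - 1)" if "m > 0"
    using that by (cases m) (auto simp: power2_eq_square)
  have DD: "(\<delta> * ?n)\<^sup>2 \<le> (real D)\<^sup>2"
    using \<delta> by (intro power_mono) auto
  have pos: "(\<delta> * ?n)\<^sup>2 > 0" using \<delta> n by simp
  let ?w = "real (card (alt_walks Nb p m a b))" and ?q = "real (card (alt_paths Nb p m U a b))"
  have "real (m * (card U + 2 * m) * D ^ (m - 1)) \<le> D ^ (m + 1) * (l * (u + 2 * l) / (\<delta> * ?n)\<^sup>2)"
  proof (cases "m = 0")
    case True
    have "l \<ge> 0" using ml by simp
    then show ?thesis using True U(2) by simp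
  next
    case False
    have "real (m * (card U + 2 * m) * D ^ (m - 1)) = real m * (card U + 2 * real m) * D ^ (m - 1)"
      by simp
    also have "\<dots> \<le> l * (u + 2 * l) * D ^ (m - 1)"
      using ml U(2) by (intro mult_right_mono mult_mono) auto
    also have "\<dots> = l * (u + 2 * l) * D ^ (m - 1) * ((\<delta> * ?n)\<^sup>2 / (\<delta> * ?n)\<^sup>2)"
      using pos by simp
    also have "\<dots> \<le> l * (u + 2 * l) * D ^ (m - 1) * ((real D)\<^sup>2 / (\<delta> * ?n)\<^sup>2)"
      using ml U(2) DD pos by (intro mult_left_mono divide_right_mono) auto
    also have "\<dots> = D ^ (m + 1) * (l * (u + 2 * l) / (\<delta> * ?n)\<^sup>2)"
      using D2 False by (simp add: field_simps)
    finally show ?thesis .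
  qed
  moreover have "?w \<le> ?q + real (m * (card U + 2 * m) * D ^ (m - 1))"
    using card_alt_walks_le_card_alt_paths[OF ab(1) U(1), of m b]
    by (simp only: of_nat_add[symmetric] of_nat_le_iff)
  moreover have "?w \<ge> D ^ (m + 1) / ?n - D ^ (m + 1) / ?n\<^sup>2"
    using card_alt_walks_bounds[OF ab m(1)] by (simp add: abs_le_iff)
  ultimately have "?q \<ge> D ^ (m + 1) / ?n - D ^ (m + 1) / ?n\<^sup>2
      - D ^ (m + 1) * (l * (u + 2 * l) / (\<delta> * ?n)\<^sup>2)"
    by linarith
  also have "D ^ (m + 1) / ?n - D ^ (m + 1) / ?n\<^sup>2 - D ^ (m + 1) * (l * (u + 2 * l) / (\<delta> * ?n)\<^sup>2)
      = (1 - path_error \<delta> \<kappa> (card V) u) * (D ^ (m + 1) / ?n)"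
  proof -
    have "x / ?n - x / ?n\<^sup>2 - x * (e / (\<delta> * ?n)\<^sup>2) = (1 - (1 / ?n + e / (\<delta>\<^sup>2 * ?n))) * (x / ?n)"
      for x e :: real
      using n \<delta>(1) by (simp add: divide_simps power2_eq_square) (simp add: algebra_simps)
    then show ?thesis
      unfolding path_error_def Let_def l_def[symmetric] .
  qed
  finally have "?q \<ge> (1 - path_error \<delta> \<kappa> (card V) u) * (D ^ (m + 1) / ?n)" .
  moreover have "(1 - path_error \<delta> \<kappa> (card V) u) * (D ^ (m + 1) / ?n) \<ge> (1 - \<epsilon>) * (D ^ (m + 1) / ?n)"
    using \<epsilon> by (intro mult_right_mono) auto
  ultimately show ?thesis by linarith
qed

end

subsection \<open>Alternating cycles as switchings\<close>

definition partner :: "'a set set \<Rightarrow> 'a \<Rightarrow> 'a" where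
  "partner M v = (THE u. {v, u} \<in> M)"

text \<open>Takes every second edge along the list. For a cycle written as a list, rotating it by
  one yields the other half of the edges.\<close>

fun pairs :: "'a list \<Rightarrow> 'a set set" where
  "pairs (x # y # zs) = insert {x, y} (pairs zs)"
| "pairs _ = {}"

fun interleave :: "('a \<Rightarrow> 'a) \<Rightarrow> 'a list \<Rightarrow> 'a list" where
  "interleave p [] = []"
| "interleave p (u # us) = u # p u # interleave p us"

lemma length_interleave [simp]: "length (interleave p us) = 2 * length us"
  by (induction us) auto

lemma interleave_inject [simp]: "interleave p us = interleave p vs \<longleftrightarrow> us = vs"
proof (induction us arbitrary: vs)
  case Nil
  then show ?case by (cases vs) auto
next
  case (Cons u us)
  then show ?case by (cases vs) auto
qed

lemma pairs_append: "even (length xs) \<Longrightarrow> pairs (xs @ ys) = pairs xs \<union> pairs ys"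
  by (induction xs rule: pairs.induct) auto

lemma Union_pairs: "even (length xs) \<Longrightarrow> \<Union> (pairs xs) = set xs"
  by (induction xs rule: pairs.induct) auto

text \<open>With \<open>Pow S\<close> as edge set, membership in
  \<open>perfect_matchings S (Pow S)\<close> says only that the sets lie in \<open>S\<close> and
  cover each of its vertices exactly once; old and new edges of a switch are handled in this
  form.\<close>

lemma pairs_perfect_matching:
  "distinct z \<Longrightarrow> even (length z) \<Longrightarrow> pairs z \<in> perfect_matchings (set z) (Pow (set z))"
proof (induction z rule: pairs.induct)
  case (1 x y zs)
  have IH: "pairs zs \<subseteq> Pow (set zs)" "\<And>v. v \<in> set zs \<Longrightarrow> \<exists>!e. e \<in> pairs zs \<and> v \<in> e"
    using 1 by (auto simp: perfect_matchings_def)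
  have "\<exists>!e. e \<in> pairs (x # y # zs) \<and> v \<in> e" if "v \<in> set (x # y # zs)" for v
  proof (cases "v \<in> set zs")
    case True
    then have "v \<notin> {x, y}" using "1.prems" by auto
    then show ?thesis using IH(2)[OF True] by auto
  next
    case False
    then have "v \<in> {x, y}" using that by auto
    moreover have "\<forall>e\<in>pairs zs. v \<notin> e" using IH(1) False by auto
    ultimately show ?thesis by (intro ex1I[of _ "{x, y}"]) auto
  qed
  then show ?case using IH(1) by (auto simp: perfect_matchings_def)
qed (auto simp: perfect_matchings_def)

lemma perfect_matching_unique:
  "M \<in> perfect_matchings V E \<Longrightarrow> v \<in> V \<Longrightarrow> e \<in> M \<Longrightarrow> e' \<in> M \<Longrightarrow> v \<in> e \<Longrightarrow> v \<in> e' \<Longrightarrow> e = e'"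
  unfolding perfect_matchings_def by blast

lemma perfect_matching_cover:
  "M \<in> perfect_matchings V E \<Longrightarrow> v \<in> V \<Longrightarrow> \<exists>e\<in>M. v \<in> e"
  unfolding perfect_matchings_def by blast

section \<open>Exchanging part of a perfect matching\<close>

definition exchange :: "'a set set \<Rightarrow> 'a set set \<Rightarrow> 'a set set \<Rightarrow> 'a set set" where
  "exchange A B M = (M - A) \<union> B"

text \<open>\<open>A\<close> and \<open>B\<close> both cover each vertex of \<open>S\<close> once
  and nothing else, so the edges at the other vertices stay as they are.\<close>

lemma exchange_perfect_matching:
  assumes M: "M \<in> perfect_matchings V E" "A \<subseteq> M" and "B \<subseteq> E"
    and A: "A \<in> perfect_matchings S (Pow S)" and B: "B \<in> perfect_matchings S (Pow S)"
    and "S \<subseteq> V"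
  shows "exchange A B M \<in> perfect_matchings V E"
proof -
  have "\<exists>!e. e \<in> (M - A) \<union> B \<and> v \<in> e" if v: "v \<in> V" for v
  proof (cases "v \<in> S")
    case True
    then obtain e where "e \<in> A" "v \<in> e" using perfect_matching_cover[OF A] by blast
    then have "\<forall>e\<in>M - A. v \<notin> e"
      using perfect_matching_unique[OF M(1) v] M(2) by blast
    moreover have "\<exists>!e. e \<in> B \<and> v \<in> e" using B True by (auto simp: perfect_matchings_def)
    ultimately show ?thesis by blast
  next
    case False
    then have "\<forall>e\<in>A \<union> B. v \<notin> e" using A B by (auto simp: perfect_matchings_def)
    moreover have "\<exists>!e. e \<in> M \<and> v \<in> e" using M v by (auto simp: perfect_matchings_def)
    ultimately show ?thesis by blast
  qed
  moreover have "(M - A) \<union> B \<subseteq> E" using assms by (auto simp: perfect_matchings_def)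
  ultimately show ?thesis by (auto simp: perfect_matchings_def exchange_def)
qed

text \<open>A common edge would contain a vertex of \<open>S\<close>, but there the only edge of
  \<open>M\<close> lies in \<open>A\<close>. Disjointness makes the exchange reversible and overlaps
  additive.\<close>

lemma disjoint_exchange:
  assumes M: "M \<in> perfect_matchings V E" "A \<subseteq> M" and "simple_graph V E" and "B \<subseteq> E"
    and A: "A \<in> perfect_matchings S (Pow S)" and B: "B \<in> perfect_matchings S (Pow S)"
    and "S \<subseteq> V"
  shows "(M - A) \<inter> B = {}"
proof -
  have False if e: "e \<in> M - A" "e \<in> B" for e
  proof -
    have "card e = 2" using assms e by (auto simp: simple_graph_def)
    then obtain v where v: "v \<in> e" by fastforce
    have "v \<in> S" using B e v by (auto simp: perfect_matchings_def)
    then obtain e' where "e' \<in> A" "v \<in> e'" using perfect_matching_cover[OF A] by blast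
    moreover have "v \<in> V" using \<open>v \<in> S\<close> assms by auto
    ultimately have "e = e'" using perfect_matching_unique[OF M(1)] M(2) e v by blast
    then show False using e \<open>e' \<in> A\<close> by blast
  qed
  then show ?thesis by blast
qed

lemma exchange_exchange: "A \<subseteq> M \<Longrightarrow> (M - A) \<inter> B = {} \<Longrightarrow> exchange B A (exchange A B M) = M"
  by (auto simp: exchange_def)

lemma card_exchange:
  assumes "finite M" "finite B" "A \<subseteq> M" "(M - A) \<inter> B = {}"
  shows "card (exchange A B M \<inter> F) + card (A \<inter> F) = card (M \<inter> F) + card (B \<inter> F)"
proof -
  have "card (exchange A B M \<inter> F) = card ((M - A) \<inter> F) + card (B \<inter> F)"
    unfolding exchange_def Int_Un_distrib2
    by (rule card_Un_disjoint) (use assms in auto)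
  moreover have "card (M \<inter> F) = card ((M - A) \<inter> F) + card (A \<inter> F)"
  proof -
    have "M \<inter> F = ((M - A) \<inter> F) \<union> (A \<inter> F)" using assms by auto
    also have "card \<dots> = card ((M - A) \<inter> F) + card (A \<inter> F)"
      by (rule card_Un_disjoint) (use assms finite_subset[of A M] in auto)
    finally show ?thesis .
  qed
  ultimately show ?thesis by simp
qed

text \<open>The exchange with \<open>A\<close> and \<open>B\<close> interchanged is the inverse map;
  \<open>P\<close> and \<open>Q\<close> stand for the overlap conditions before and after.\<close>

lemma card_exchange_eq:
  assumes E: "simple_graph V E" and AE: "A \<subseteq> E" and BE: "B \<subseteq> E"
    and A: "A \<in> perfect_matchings S (Pow S)" and B: "B \<in> perfect_matchings S (Pow S)"
    and S: "S \<subseteq> V"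
    and PQ: "\<And>M. M \<in> perfect_matchings V E \<Longrightarrow> A \<subseteq> M \<Longrightarrow> (M - A) \<inter> B = {} \<Longrightarrow>
      P M \<longleftrightarrow> Q (exchange A B M)"
  shows "card {M \<in> perfect_matchings V E. P M \<and> A \<subseteq> M} =
    card {M \<in> perfect_matchings V E. Q M \<and> B \<subseteq> M}"
proof (rule bij_betw_same_card[of "exchange A B"], rule bij_betw_byWitness[where f' = "exchange B A"])
  let ?X = "{M \<in> perfect_matchings V E. P M \<and> A \<subseteq> M}"
  let ?Y = "{M \<in> perfect_matchings V E. Q M \<and> B \<subseteq> M}"
  note disjA = disjoint_exchange[OF _ _ E BE A B S] and disjB = disjoint_exchange[OF _ _ E AE B A S]
  note pmA = exchange_perfect_matching[OF _ _ BE A B S]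
    and pmB = exchange_perfect_matching[OF _ _ AE B A S]
  show "\<forall>M\<in>?X. exchange B A (exchange A B M) = M"
    using exchange_exchange[OF _ disjA] by simp
  show "\<forall>M\<in>?Y. exchange A B (exchange B A M) = M"
    using exchange_exchange[OF _ disjB] by simp
  have sub: "B \<subseteq> exchange A B M" "A \<subseteq> exchange B A M" for M
    by (auto simp: exchange_def)
  show "exchange A B ` ?X \<subseteq> ?Y"
  proof
    fix N assume "N \<in> exchange A B ` ?X"
    then obtain M where M: "M \<in> perfect_matchings V E" "P M" "A \<subseteq> M" "N = exchange A B M" by blast
    then show "N \<in> ?Y" using pmA[OF M(1,3)] PQ[OF M(1,3) disjA[OF M(1,3)]] sub by simp
  qed
  show "exchange B A ` ?Y \<subseteq> ?X"
  proof
    fix N assume "N \<in> exchange B A ` ?Y"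
    then obtain M where M: "M \<in> perfect_matchings V E" "Q M" "B \<subseteq> M" "N = exchange B A M" by blast
    have N: "N \<in> perfect_matchings V E" "A \<subseteq> N" using pmB[OF M(1,3)] sub M(4) by auto
    have "exchange A B N = M" using exchange_exchange[OF M(3) disjB[OF M(1,3)]] M(4) by simp
    then show "N \<in> ?X" using PQ[OF N disjA[OF N]] M(2) N by simp
  qed
qed

lemma finite_simple_graph: "simple_graph V E \<Longrightarrow> finite E"
  unfolding simple_graph_def by (meson PowI finite_Pow_iff finite_subset subsetI)

lemma finite_perfect_matchings: "simple_graph V E \<Longrightarrow> finite (perfect_matchings V E)"
  by (rule finite_subset[of _ "Pow E"]) (auto simp: perfect_matchings_def finite_simple_graph)

text \<open>A switch is a cycle rooted at an oriented edge, so edges are counted as ordered pairs;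
  hence the 2 in the Poisson parameter.\<close>

definition arcs :: "'a set set \<Rightarrow> ('a \<times> 'a) set" where
  "arcs A = {(x, y). {x, y} \<in> A}"

lemma arcs_eq_Sigma:
  assumes "simple_graph V A"
  shows "arcs A = (SIGMA x : V. neighbours A x)"
  using assms by (auto simp: arcs_def neighbours_def simple_graph_def)

lemma neighbours_subset: "simple_graph V A \<Longrightarrow> neighbours A x \<subseteq> V"
  by (auto simp: neighbours_def simple_graph_def)

lemma finite_arcs: "simple_graph V A \<Longrightarrow> finite (arcs A)"
  using neighbours_subset by (metis arcs_eq_Sigma finite_SigmaI finite_subset simple_graph_def)

lemma card_arcs:
  fixes A :: "'a set set"
  assumes "finite A" "\<forall>e\<in>A. card e = 2"
  shows "card (arcs A) = 2 * card A"
proof -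
  have "arcs A = (\<Union>e\<in>A. {(x, y). {x, y} = e})"
    by (auto simp: arcs_def)
  moreover have two: "card {(x, y). {x, y} = e} = 2 \<and> finite {(x, y). {x, y} = e}" if "e \<in> A" for e
  proof -
    have "card e = 2" using assms(2) that by blast
    then obtain a b where ab: "e = {a, b}" "a \<noteq> b"
      unfolding card_2_iff by blast
    then have "{(x, y). {x, y} = e} = {(a, b), (b, a)}"
      by (auto simp: doubleton_eq_iff)
    then show ?thesis using ab by auto
  qed
  moreover have "card (\<Union>e\<in>A. {(x, y). {x, y} = e}) = (\<Sum>e\<in>A. card {(x, y). {x, y} = e})"
    using assms(1) two by (intro card_UN_disjoint) blast+
  ultimately show ?thesis by simp
qed

lemma card_arcs_regular:
  assumes "regular_graph V A r"
  shows "card (arcs A) = r * card V"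
proof -
  have "finite V" "simple_graph V A" using assms by (auto simp: regular_graph_def simple_graph_def)
  then have "card (arcs A) = (\<Sum>x\<in>V. card (neighbours A x))"
    unfolding arcs_eq_Sigma[OF \<open>simple_graph V A\<close>]
    using finite_subset[OF neighbours_subset[OF \<open>simple_graph V A\<close>]] by (intro card_SigmaI) auto
  then show ?thesis using assms by (simp add: regular_graph_def)
qed

text \<open>A switch \<open>(x, y, zs)\<close> is an alternating cycle: a perfect matching containing its \<open>old_edges\<close>
  may trade them for its \<open>new_edges\<close>.\<close>

definition switches :: "'a set set \<Rightarrow> 'a set set \<Rightarrow> nat \<Rightarrow> ('a \<times> 'a \<times> 'a list) set" where
  "switches F H m = {(x, y, zs). length zs = 2 * m \<and> distinct (x # y # zs) \<and> {x, y} \<in> F \<and>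
     successively (\<lambda>u v. {u, v} \<in> H) (y # zs @ [x])}"

definition old_edges :: "'a \<times> 'a \<times> 'a list \<Rightarrow> 'a set set" where
  "old_edges = (\<lambda>(x, y, zs). pairs (x # y # zs))"

definition new_edges :: "'a \<times> 'a \<times> 'a list \<Rightarrow> 'a set set" where
  "new_edges = (\<lambda>(x, y, zs). pairs (y # zs @ [x]))"

definition switches_from :: "'a set set \<Rightarrow> 'a set set \<Rightarrow> nat \<Rightarrow> 'a set set \<Rightarrow> ('a \<times> 'a \<times> 'a list) set" where
  "switches_from F H m M = {z \<in> switches F H m. old_edges z \<subseteq> M}"

definition switches_to :: "'a set set \<Rightarrow> 'a set set \<Rightarrow> nat \<Rightarrow> 'a set set \<Rightarrow> ('a \<times> 'a \<times> 'a list) set" where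
  "switches_to F H m M = {z \<in> switches F H m. new_edges z \<subseteq> M}"

lemma successively_Cons_snoc_set:
  assumes "successively (\<lambda>u v. {u, v} \<in> H) (a # zs @ [b])" "simple_graph V H"
  shows "set (a # zs @ [b]) \<subseteq> V"
  using assms
proof (induction zs arbitrary: a)
  case Nil
  then show ?case by (auto simp: simple_graph_def)
next
  case (Cons z zs)
  then have "{a, z} \<in> H" by simp
  then have "a \<in> V" using Cons.prems by (auto simp: simple_graph_def)
  then show ?case using Cons by auto
qed

lemma pairs_subset_successively:
  "successively (\<lambda>u v. {u, v} \<in> H) zs \<Longrightarrow> pairs zs \<subseteq> H"
  by (induction zs rule: pairs.induct) (auto simp: successively_Cons)

lemma switches_set:
  "(x, y, zs) \<in> switches F H m \<Longrightarrow> simple_graph V H \<Longrightarrow> insert x (insert y (set zs)) \<subseteq> V"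
  using successively_Cons_snoc_set[of H y zs x V] by (auto simp: switches_def)

lemma finite_switches:
  assumes "simple_graph V H"
  shows "finite (switches F H m)"
proof (rule finite_subset)
  show "switches F H m \<subseteq> V \<times> V \<times> {zs. set zs \<subseteq> V \<and> length zs = 2 * m}"
    using switches_set[OF _ assms] by (fastforce simp: switches_def)
  show "finite (V \<times> V \<times> {zs. set zs \<subseteq> V \<and> length zs = 2 * m})"
    using assms by (auto simp: simple_graph_def finite_lists_length_eq)
qed

lemma old_edges_matching:
  assumes "(x, y, zs) \<in> switches F H m"
  shows "old_edges (x, y, zs) \<in> perfect_matchings (set (x # y # zs)) (Pow (set (x # y # zs)))"
  unfolding old_edges_def prod.case
  by (rule pairs_perfect_matching) (use assms in \<open>auto simp: switches_def\<close>)

lemma new_edges_matching: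
  assumes "(x, y, zs) \<in> switches F H m"
  shows "new_edges (x, y, zs) \<in> perfect_matchings (set (x # y # zs)) (Pow (set (x # y # zs)))"
proof -
  have "set (y # zs @ [x]) = set (x # y # zs)" by auto
  moreover have "new_edges (x, y, zs) \<in> perfect_matchings (set (y # zs @ [x])) (Pow (set (y # zs @ [x])))"
    unfolding new_edges_def prod.case
    by (rule pairs_perfect_matching) (use assms in \<open>auto simp: switches_def\<close>)
  ultimately show ?thesis by simp
qed

lemma new_edges_subset: "(x, y, zs) \<in> switches F H m \<Longrightarrow> new_edges (x, y, zs) \<subseteq> H"
  using pairs_subset_successively by (auto simp: switches_def new_edges_def)

lemma successively_tail:
  "successively P (y # zs @ [x]) \<Longrightarrow> successively P zs"
  by (auto simp: successively_Cons successively_append_iff)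

lemma old_edges_subset:
  assumes "(x, y, zs) \<in> switches F H m"
  shows "old_edges (x, y, zs) \<subseteq> insert {x, y} H" "{x, y} \<in> F" "{x, y} \<in> old_edges (x, y, zs)"
proof -
  have "successively (\<lambda>u v. {u, v} \<in> H) (y # zs @ [x])"
    using assms by (simp add: switches_def)
  then have "pairs zs \<subseteq> H"
    by (rule pairs_subset_successively[OF successively_tail])
  then show "old_edges (x, y, zs) \<subseteq> insert {x, y} H" "{x, y} \<in> old_edges (x, y, zs)"
    unfolding old_edges_def prod.case pairs.simps by blast+
  show "{x, y} \<in> F"
    using assms by (simp add: switches_def)
qed

text \<open>Both sides count pairs of a matching and a switch. Summed over switches they agree term
  by term, since for a fixed switch the exchange is a bijection.\<close>

lemma switches_double_count:
  fixes P Q :: "'a set set \<Rightarrow> bool"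
  assumes E: "simple_graph V E" and FE: "F \<subseteq> E" and HE: "H \<subseteq> E"
    and PQ: "\<And>z M. z \<in> switches F H m \<Longrightarrow> M \<in> perfect_matchings V E \<Longrightarrow> old_edges z \<subseteq> M \<Longrightarrow>
      (M - old_edges z) \<inter> new_edges z = {} \<Longrightarrow> P M \<longleftrightarrow> Q (exchange (old_edges z) (new_edges z) M)"
  shows "(\<Sum>M | M \<in> perfect_matchings V E \<and> P M. card (switches_from F H m M)) =
    (\<Sum>M | M \<in> perfect_matchings V E \<and> Q M. card (switches_to F H m M))"
proof -
  let ?PM = "perfect_matchings V E"
  let ?Z = "switches F H m"
  have H: "simple_graph V H" using E HE by (auto simp: simple_graph_def)
  have fin: "finite ?PM" "finite ?Z"
    using finite_perfect_matchings[OF E] finite_switches[OF H] by auto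
  have dc: "(\<Sum>M\<in>{M \<in> ?PM. R M}. card {z \<in> ?Z. f z \<subseteq> M}) = (\<Sum>z\<in>?Z. card {M \<in> ?PM. R M \<and> f z \<subseteq> M})"
    for R :: "'a set set \<Rightarrow> bool" and f :: "'a \<times> 'a \<times> 'a list \<Rightarrow> 'a set set"
    using sum.swap_restrict[of "{M \<in> ?PM. R M}" ?Z "\<lambda>_ _. 1::nat" "\<lambda>M z. f z \<subseteq> M"] fin
    by (simp add: conj_assoc)
  have "card {M \<in> ?PM. P M \<and> old_edges z \<subseteq> M} = card {M \<in> ?PM. Q M \<and> new_edges z \<subseteq> M}"
    if z: "z \<in> ?Z" for z
  proof -
    obtain x y zs where xyz: "z = (x, y, zs)" by (cases z)
    note zz = z[unfolded xyz]
    have "old_edges z \<subseteq> E" "new_edges z \<subseteq> E"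
      using old_edges_subset[OF zz] new_edges_subset[OF zz] FE HE xyz by blast+
    moreover have "set (x # y # zs) \<subseteq> V"
      using switches_set[OF zz H] by simp
    ultimately show ?thesis
      unfolding xyz
      using card_exchange_eq[where P = P and Q = Q, OF E _ _ old_edges_matching[OF zz] new_edges_matching[OF zz]]
        PQ[OF zz] by blast
  qed
  then show ?thesis
    unfolding switches_from_def switches_to_def using dc[of old_edges P] dc[of new_edges Q] by simp
qed

subsection \<open>Switchings of a fixed matching\<close>

lemma perfect_matching_edge:
  assumes E: "simple_graph V E" and M: "M \<in> perfect_matchings V E" and v: "v \<in> V"
  obtains u where "{v, u} \<in> M" "u \<in> V" "u \<noteq> v"
proof -
  obtain e where e: "e \<in> M" "v \<in> e" using perfect_matching_cover[OF M v] by blast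
  then have "e \<subseteq> V" "card e = 2" using E M by (auto simp: simple_graph_def perfect_matchings_def)
  then obtain a b where "e = {a, b}" "a \<noteq> b" by (auto simp: card_2_iff)
  then show ?thesis using e \<open>e \<subseteq> V\<close> that[of a] that[of b] by (auto simp: insert_commute)
qed

lemma partner_eq:
  assumes M: "M \<in> perfect_matchings V E" and v: "v \<in> V" and "{v, u} \<in> M"
  shows "partner M v = u"
  unfolding partner_def
proof (rule the_equality)
  fix w assume "{v, w} \<in> M"
  then have "{v, w} = {v, u}" using perfect_matching_unique[OF M v] assms(3) by blast
  then show "w = u" by (auto simp: doubleton_eq_iff)
qed fact

lemma simple_graph_edge:
  "simple_graph V E \<Longrightarrow> {a, b} \<in> E \<Longrightarrow> a \<in> V \<and> b \<in> V \<and> a \<noteq> b"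
  by (auto simp: simple_graph_def card_insert_if split: if_splits)

text \<open>\<open>E\<close> hosts the matching, while the steps off the matching are taken in
  \<open>H\<close>. It is instantiated with \<open>E - F\<close> inside \<open>E\<close>, with
  \<open>E\<close> inside itself, and with \<open>E\<close> inside the complete graph.\<close>

locale matched_graph =
  fixes V :: "'a set" and E H M :: "'a set set" and D :: nat
  assumes E: "simple_graph V E" and H: "regular_graph V H D" and D: "D > 0"
    and M: "M \<in> perfect_matchings V E"
begin

abbreviation "p \<equiv> partner M"
abbreviation "Nb \<equiv> neighbours H"

text \<open>The vertices at which the step along \<open>M\<close> leaves \<open>H\<close>; a path
  that avoids them runs entirely in \<open>H\<close>.\<close>

definition W :: "'a set" where
  "W = \<Union> (M - H)"

lemma simple_H: "simple_graph V H"
  using H by (simp add: regular_graph_def)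

lemma M_subset: "M \<subseteq> E"
  using M by (simp add: perfect_matchings_def)

lemma finite_M: "finite M"
  using M_subset finite_simple_graph[OF E] finite_subset by blast

lemma partner: assumes "v \<in> V" shows "{v, p v} \<in> M" "p v \<in> V" "p v \<noteq> v" "p (p v) = v"
proof -
  obtain u where u: "{v, u} \<in> M" "u \<in> V" "u \<noteq> v"
    using perfect_matching_edge[OF E M assms] .
  have "p v = u" using partner_eq[OF M assms u(1)] .
  moreover have "p u = v" using partner_eq[OF M u(2)] u(1) by (simp add: insert_commute)
  ultimately show "{v, p v} \<in> M" "p v \<in> V" "p v \<noteq> v" "p (p v) = v" using u by simp_all
qed

lemma edge_M: "{a, b} \<in> M \<Longrightarrow> a \<in> V \<and> b \<in> V \<and> p a = b \<and> p b = a"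
  using simple_graph_edge[OF E, of a b] M_subset partner_eq[OF M, of a b] partner_eq[OF M, of b a]
  by (auto simp: insert_commute)

sublocale alternation V Nb D p
proof
  show "finite V" using E by (simp add: simple_graph_def)
  show "Nb v \<subseteq> V" for v using neighbours_subset[OF simple_H] .
  show "v \<in> Nb u" if "u \<in> Nb v" for u v using that by (simp add: neighbours_def insert_commute)
qed (use H D partner in \<open>auto simp: regular_graph_def\<close>)

lemma W_partner:
  assumes "w \<in> W" shows "p w \<in> W"
proof -
  obtain e where e: "e \<in> M" "e \<notin> H" "w \<in> e" using assms by (auto simp: W_def)
  then have w: "w \<in> V" using M_subset E by (auto simp: simple_graph_def)
  have "e = {w, p w}"
    using perfect_matching_unique[OF M w e(1) partner(1)[OF w] e(3)] by simp
  then show ?thesis using e by (auto simp: W_def)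
qed

lemma W_subset: "W \<subseteq> V"
  using M_subset E by (auto simp: W_def simple_graph_def)

lemma card_W: "card W \<le> 2 * card (M - H)"
proof -
  have "card W \<le> (\<Sum>e\<in>M - H. card e)"
    unfolding W_def by (rule card_Union_le_sum_card)
  also have "\<dots> = (\<Sum>e\<in>M - H. 2)"
    using M_subset E by (intro sum.cong) (auto simp: simple_graph_def)
  finally show ?thesis by simp
qed

lemma edge_not_W: "v \<in> V \<Longrightarrow> v \<notin> W \<Longrightarrow> {v, p v} \<in> H"
  using partner(1)[of v] by (auto simp: W_def)

lemma pairs_interleave: "set us \<subseteq> V \<Longrightarrow> pairs (interleave p us) \<subseteq> M"
  by (induction us) (auto simp: partner)

lemma alt_path_set: "alt_path Nb p b U a us \<Longrightarrow> set us \<subseteq> V"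
  by (induction us arbitrary: U a)
    (use neighbours_subset[OF simple_H] in \<open>auto simp: subset_iff\<close>)

lemma alt_path_interleave:
  assumes "alt_path Nb p b U a us" "\<And>w. w \<in> U \<Longrightarrow> p w \<in> U"
  shows "distinct (interleave p us) \<and> set (interleave p us) \<inter> U = {}"
  using assms
proof (induction us arbitrary: U a)
  case (Cons u us)
  let ?U = "insert u (insert (p u) U)"
  have u: "u \<in> Nb a" "u \<notin> U" and q: "alt_path Nb p b ?U (p u) us" using Cons.prems by auto
  have uV: "u \<in> V" using u neighbours_subset[OF simple_H] by blast
  have closed: "p w \<in> ?U" if "w \<in> ?U" for w
    using that Cons.prems(2) partner[OF uV] by auto
  have IH: "distinct (interleave p us)" "set (interleave p us) \<inter> ?U = {}"
    using Cons.IH[OF q closed] by blast+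
  have "p u \<notin> U"
    using Cons.prems(2)[of "p u"] u partner(4)[OF uV] by auto
  then show ?case
    using IH u partner(3)[OF uV] by auto
qed simp

lemma alt_path_successively:
  assumes "alt_path Nb p b U a us" "W \<subseteq> U"
  shows "successively (\<lambda>x y. {x, y} \<in> H) (a # interleave p us @ [b])"
  using assms
proof (induction us arbitrary: U a)
  case Nil
  then show ?case by (simp add: neighbours_def)
next
  case (Cons u us)
  have u: "u \<in> Nb a" "u \<notin> U" using Cons.prems by auto
  have uV: "u \<in> V" using u neighbours_subset[OF simple_H] by blast
  have "{u, p u} \<in> H" using edge_not_W[OF uV] u Cons.prems(2) by blast
  moreover have "{a, u} \<in> H" using u by (simp add: neighbours_def)
  moreover have "successively (\<lambda>x y. {x, y} \<in> H) (p u # interleave p us @ [b])"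
    by (rule Cons.IH[of "insert u (insert (p u) U)"]) (use Cons.prems in auto)
  ultimately show ?case by simp
qed

lemma alt_walk_pairs:
  "alt_walk Nb p b a us \<Longrightarrow> pairs (a # interleave p us @ [b]) \<subseteq> H"
  by (induction us arbitrary: a) (auto simp: neighbours_def)

text \<open>\<open>M\<close> determines every second vertex of such a list, so it is an interleaved
  walk. This bounds the number of switches above by numbers of walks.\<close>

lemma interleave_of_pairs:
  assumes "pairs zs \<subseteq> M" "length zs = 2 * m" "successively (\<lambda>x y. {x, y} \<in> H) (a # zs @ [b])"
  shows "\<exists>us. zs = interleave p us \<and> length us = m \<and> alt_walk Nb p b a us"
  using assms
proof (induction m arbitrary: zs a)
  case 0
  then show ?case by (auto simp: neighbours_def)
next
  case (Suc m)
  then obtain u v zs' where zs: "zs = u # v # zs'"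
    by (cases zs; cases "tl zs") auto
  have "\<exists>us. zs' = interleave p us \<and> length us = m \<and> alt_walk Nb p b v us"
    by (rule Suc.IH) (use Suc.prems zs in auto)
  then obtain us where us: "zs' = interleave p us" "length us = m" "alt_walk Nb p b v us"
    by blast
  have "v = p u" using edge_M[of u v] Suc.prems(1) zs by auto
  moreover have "u \<in> Nb a" using Suc.prems(3) zs by (simp add: neighbours_def)
  ultimately show ?case
    using us zs by (intro exI[of _ "u # us"]) auto
qed

text \<open>The path from \<open>y\<close> to \<open>x\<close> is closed by the matching edge
  \<open>{x, y}\<close>; avoiding \<open>W\<close> puts all its own edges into
  \<open>H\<close>.\<close>

lemma switch_fromI:
  assumes xy: "{x, y} \<in> M" "{x, y} \<in> F" and us: "us \<in> alt_paths Nb p m ({x, y} \<union> W) y x"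
  shows "(x, y, interleave p us) \<in> switches_from F H m M"
proof -
  have V: "x \<in> V" "y \<in> V" "p x = y" "p y = x" using edge_M[OF xy(1)] by auto
  then have "x \<noteq> y" using partner by metis
  have us': "length us = m" "alt_path Nb p x ({x, y} \<union> W) y us"
    using us by (auto simp: alt_paths_def)
  have closed: "p w \<in> {x, y} \<union> W" if "w \<in> {x, y} \<union> W" for w
    using that V W_partner by auto
  have "distinct (interleave p us) \<and> set (interleave p us) \<inter> ({x, y} \<union> W) = {}"
    by (rule alt_path_interleave[OF us'(2) closed])
  moreover have "successively (\<lambda>x y. {x, y} \<in> H) (y # interleave p us @ [x])"
    by (rule alt_path_successively[OF us'(2)]) auto
  moreover have "pairs (interleave p us) \<subseteq> M"
    by (rule pairs_interleave[OF alt_path_set[OF us'(2)]])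
  ultimately show ?thesis
    using xy us'(1) \<open>x \<noteq> y\<close>
    by (auto simp: switches_from_def switches_def old_edges_def simp del: successively.simps)
qed

lemma finite_switches_from: "finite (switches_from F H m M)"
  using finite_switches[OF simple_H, of F m] by (simp add: switches_from_def)

lemma finite_switches_to: "finite (switches_to F H m M)"
  using finite_switches[OF simple_H, of F m] by (simp add: switches_to_def)

lemma simple_M: "simple_graph V M"
  using E M_subset by (auto simp: simple_graph_def)

lemma finite_arcs_M: "finite (arcs (M \<inter> F))"
  by (rule finite_arcs[of V]) (use simple_M in \<open>auto simp: simple_graph_def\<close>)

lemma arcs_M_V: "(x, y) \<in> arcs (M \<inter> F) \<Longrightarrow> x \<in> V \<and> y \<in> V"
  by (auto simp: arcs_def dest: edge_M)

lemma card_switches_from_ge: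
  "(\<Sum>(x, y)\<in>arcs (M \<inter> F). card (alt_paths Nb p m ({x, y} \<union> W) y x)) \<le> card (switches_from F H m M)"
proof -
  let ?A = "SIGMA xy : arcs (M \<inter> F). alt_paths Nb p m ({fst xy, snd xy} \<union> W) (snd xy) (fst xy)"
  let ?f = "\<lambda>((x, y), us). (x, y, interleave p us)"
  have "(\<Sum>(x, y)\<in>arcs (M \<inter> F). card (alt_paths Nb p m ({x, y} \<union> W) y x)) = card ?A"
    by (subst card_SigmaI)
      (auto simp: finite_arcs_M case_prod_beta dest!: arcs_M_V intro!: finite_alt_paths)
  also have "\<dots> = card (?f ` ?A)"
    by (rule card_image[symmetric]) (auto simp: inj_on_def)
  also have "\<dots> \<le> card (switches_from F H m M)"
    by (rule card_mono[OF finite_switches_from]) (auto simp: arcs_def intro!: switch_fromI)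
  finally show ?thesis .
qed

lemma card_switches_from_le:
  "card (switches_from F H m M) \<le> (\<Sum>(x, y)\<in>arcs (M \<inter> F). card (alt_walks Nb p m y x))"
proof -
  let ?A = "SIGMA xy : arcs (M \<inter> F). alt_walks Nb p m (snd xy) (fst xy)"
  let ?f = "\<lambda>((x, y), us). (x, y, interleave p us)"
  have "finite ?A"
    by (intro finite_SigmaI finite_arcs_M finite_alt_walks)
      (auto simp: arcs_def dest!: edge_M)
  have "z \<in> ?f ` ?A" if z: "z \<in> switches_from F H m M" for z
  proof -
    obtain x y zs where xyz: "z = (x, y, zs)" by (cases z)
    have *: "{x, y} \<in> M" "{x, y} \<in> F" "pairs zs \<subseteq> M" "length zs = 2 * m"
        "successively (\<lambda>x y. {x, y} \<in> H) (y # zs @ [x])"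
      using z by (auto simp: xyz switches_from_def switches_def old_edges_def simp del: successively.simps)
    obtain us where "zs = interleave p us" "length us = m" "alt_walk Nb p x y us"
      using interleave_of_pairs[OF *(3-5)] by blast
    then have "((x, y), us) \<in> ?A" "z = ?f ((x, y), us)"
      using * by (auto simp: arcs_def alt_walks_def xyz)
    then show ?thesis by blast
  qed
  then have "card (switches_from F H m M) \<le> card ?A"
    by (intro surj_card_le[OF \<open>finite ?A\<close>, of _ ?f] subsetI)
  also have "\<dots> = (\<Sum>(x, y)\<in>arcs (M \<inter> F). card (alt_walks Nb p m y x))"
    by (subst card_SigmaI)
      (auto simp: finite_arcs_M case_prod_beta dest!: arcs_M_V intro!: finite_alt_walks)
  finally show ?thesis .
qed

text \<open>The new edges at \<open>y\<close> and \<open>x\<close> lie in \<open>M\<close>, so their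
  other ends are \<open>p y\<close> and \<open>p x\<close>. What is left to choose is a walk between
  these two, with \<open>m\<close> listed vertices instead of \<open>Suc m\<close>.\<close>

lemma card_switches_to_le:
  assumes F: "simple_graph V F"
  shows "card (switches_to F H (Suc m) M) \<le> (\<Sum>(x, y)\<in>arcs F. card (alt_walks Nb p m (p y) (p x)))"
proof -
  let ?A = "SIGMA xy : arcs F. alt_walks Nb p m (p (snd xy)) (p (fst xy))"
  let ?f = "\<lambda>((x, y), us). (x, y, p y # interleave p us @ [p x])"
  have arcs_V: "x \<in> V \<and> y \<in> V" if "(x, y) \<in> arcs F" for x y
    using that simple_graph_edge[OF F] by (simp add: arcs_def)
  have "finite ?A"
    by (intro finite_SigmaI finite_arcs[OF F] finite_alt_walks) (auto dest!: arcs_V simp: partner)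
  have "z \<in> ?f ` ?A" if z: "z \<in> switches_to F H (Suc m) M" for z
  proof -
    obtain x y zs0 where xyz0: "z = (x, y, zs0)" by (cases z)
    have "length zs0 = Suc (Suc (2 * m))" using z xyz0 by (simp add: switches_to_def switches_def)
    then obtain y' zs1 where "zs0 = y' # zs1" "length zs1 = Suc (2 * m)"
      by (auto simp: length_Suc_conv)
    moreover obtain zs x' where "zs1 = zs @ [x']" "length zs = 2 * m"
      using \<open>length zs1 = Suc (2 * m)\<close> by (auto simp: length_Suc_conv_rev)
    ultimately have xyz: "z = (x, y, y' # zs @ [x'])" and len: "length zs = 2 * m"
      using xyz0 by auto
    have F: "{x, y} \<in> F" and
      s: "successively (\<lambda>x y. {x, y} \<in> H) (y # y' # zs @ [x', x])"
      using z by (auto simp: xyz switches_to_def switches_def simp del: successively.simps)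
    have "pairs (y # y' # zs @ [x', x]) \<subseteq> M"
      using z by (simp add: xyz switches_to_def new_edges_def)
    then have pr: "{y, y'} \<in> M" "pairs zs \<subseteq> M" "{x', x} \<in> M"
      using len by (auto simp: pairs_append)
    have s': "successively (\<lambda>x y. {x, y} \<in> H) (y' # zs @ [x'])"
    proof -
      have "successively (\<lambda>x y. {x, y} \<in> H) ([y] @ (y' # zs @ [x']) @ [x])"
        using s by simp
      then show ?thesis unfolding successively_append_iff by blast
    qed
    have px: "x' = p x" "y' = p y" using edge_M[OF pr(1)] edge_M[OF pr(3)] by auto
    obtain us where "zs = interleave p us" "length us = m" "alt_walk Nb p x' y' us"
      using interleave_of_pairs[OF pr(2) len s'] by blast
    then have "((x, y), us) \<in> ?A" "z = ?f ((x, y), us)"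
      using F px by (auto simp: arcs_def alt_walks_def xyz)
    then show ?thesis by blast
  qed
  then have "card (switches_to F H (Suc m) M) \<le> card ?A"
    by (intro surj_card_le[OF \<open>finite ?A\<close>, of _ ?f] subsetI)
  also have "\<dots> = (\<Sum>(x, y)\<in>arcs F. card (alt_walks Nb p m (p y) (p x)))"
    by (subst card_SigmaI)
      (auto simp: finite_arcs[OF F] case_prod_beta dest!: arcs_V intro!: finite_alt_walks partner)
  finally show ?thesis .
qed

lemma switch_toI:
  assumes xy: "{x, y} \<in> F" "x \<in> V - W" "y \<in> V - W" "x \<noteq> y" "{x, y} \<notin> H"
    and us: "us \<in> alt_paths Nb p m ({x, y, p x, p y} \<union> W) (p y) (p x)"
  shows "(x, y, p y # interleave p us @ [p x]) \<in> switches_to F H (Suc m) M"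
proof -
  let ?U = "{x, y, p x, p y} \<union> W"
  have us': "length us = m" "alt_path Nb p (p x) ?U (p y) us"
    using us by (auto simp: alt_paths_def)
  have closed: "p w \<in> ?U" if "w \<in> ?U" for w
    using that partner xy W_partner by auto
  have d: "distinct (interleave p us) \<and> set (interleave p us) \<inter> ?U = {}"
    by (rule alt_path_interleave[OF us'(2) closed])
  have H: "{y, p y} \<in> H" "{p x, x} \<in> H"
    using edge_not_W xy by (auto simp: insert_commute)
  \<comment> \<open>As \<open>x\<close> is outside \<open>W\<close>, its matching edge lies in
    \<open>H\<close>, whereas \<open>{x, y}\<close> does not.\<close>
  then have "p x \<noteq> y" using xy(5) by (auto simp: insert_commute)
  then have "p y \<noteq> x" "p x \<noteq> p y" using partner(4) xy by (metis DiffD1)+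
  define L where "L = p y # interleave p us @ [p x]"
  have "successively (\<lambda>x y. {x, y} \<in> H) L"
    unfolding L_def by (rule alt_path_successively[OF us'(2)]) auto
  moreover have "L \<noteq> []" "hd L = p y" "last L = p x" by (auto simp: L_def)
  ultimately have "successively (\<lambda>x y. {x, y} \<in> H) (y # L @ [x])"
    using H by (simp add: successively_Cons successively_append_iff)
  then have s: "successively (\<lambda>x y. {x, y} \<in> H) (y # (p y # interleave p us @ [p x]) @ [x])"
    by (simp only: L_def)
  have "pairs (interleave p us) \<subseteq> M"
    by (rule pairs_interleave[OF alt_path_set[OF us'(2)]])
  then have "pairs (y # (p y # interleave p us @ [p x]) @ [x]) \<subseteq> M"
    using partner(1)[of x] partner(1)[of y] xy by (simp add: pairs_append insert_commute)
  moreover have "distinct (x # y # p y # interleave p us @ [p x])"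
    using d xy \<open>p x \<noteq> y\<close> \<open>p y \<noteq> x\<close> \<open>p x \<noteq> p y\<close> partner(3)[of x] partner(3)[of y] by auto
  ultimately show ?thesis
    using s xy(1) us'(1)
    by (simp add: switches_to_def switches_def new_edges_def del: successively.simps)
qed

lemma card_switches_to_ge:
  assumes F: "simple_graph V F" and FH: "F \<inter> H = {}"
  shows "(\<Sum>(x, y)\<in>{(x, y) \<in> arcs F. x \<notin> W \<and> y \<notin> W}.
      card (alt_paths Nb p m ({x, y, p x, p y} \<union> W) (p y) (p x))) \<le> card (switches_to F H (Suc m) M)"
proof -
  let ?R = "{(x, y) \<in> arcs F. x \<notin> W \<and> y \<notin> W}"
  let ?A = "SIGMA xy : ?R. alt_paths Nb p m ({fst xy, snd xy, p (fst xy), p (snd xy)} \<union> W)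
     (p (snd xy)) (p (fst xy))"
  let ?f = "\<lambda>((x, y), us). (x, y, p y # interleave p us @ [p x])"
  have arcs_V: "x \<in> V \<and> y \<in> V \<and> x \<noteq> y" if "(x, y) \<in> arcs F" for x y
    using that simple_graph_edge[OF F] by (simp add: arcs_def)
  have "finite ?R" by (rule finite_subset[OF _ finite_arcs[OF F]]) auto
  then have "(\<Sum>(x, y)\<in>?R. card (alt_paths Nb p m ({x, y, p x, p y} \<union> W) (p y) (p x))) = card ?A"
    by (subst card_SigmaI)
      (auto simp: case_prod_beta dest!: arcs_V intro!: finite_alt_paths partner)
  also have "\<dots> = card (?f ` ?A)"
    by (rule card_image[symmetric]) (auto simp: inj_on_def)
  also have "\<dots> \<le> card (switches_to F H (Suc m) M)"
  proof (rule card_mono[OF finite_switches_to], safe)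
    fix x y us assume a: "(x, y) \<in> arcs F" "x \<notin> W" "y \<notin> W"
      and us: "us \<in> alt_paths Nb p m ({fst (x, y), snd (x, y), p (fst (x, y)), p (snd (x, y))} \<union> W)
        (p (snd (x, y))) (p (fst (x, y)))"
    then show "(x, y, p y # interleave p us @ [p x]) \<in> switches_to F H (Suc m) M"
      using arcs_V[OF a(1)] FH by (intro switch_toI) (auto simp: arcs_def)
  qed
  finally show ?thesis .
qed

text \<open>Each vertex of \<open>W\<close> spoils at most \<open>r\<close> arcs as first end and
  \<open>r\<close> as second end.\<close>

lemma card_arcs_avoiding:
  assumes F: "regular_graph V F r"
  shows "r * card V \<le> card {(x, y) \<in> arcs F. x \<notin> W \<and> y \<notin> W} + 2 * r * card W"
proof -
  have sF: "simple_graph V F" using F by (simp add: regular_graph_def)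
  have fin: "finite (arcs F)" by (rule finite_arcs[OF sF])
  let ?B = "SIGMA w : W. neighbours F w"
  have finW: "finite W" using W_subset finite_V finite_subset by blast
  have finN: "finite (neighbours F w)" for w
    using neighbours_subset[OF sF] finite_V finite_subset by blast
  have "card ?B = (\<Sum>w\<in>W. card (neighbours F w))"
    using finW finN by (intro card_SigmaI) auto
  also have "\<dots> = (\<Sum>w\<in>W. r)"
    using F W_subset by (intro sum.cong) (auto simp: regular_graph_def)
  finally have B: "card ?B = r * card W" by simp
  have sub: "arcs F \<subseteq> {(x, y) \<in> arcs F. x \<notin> W \<and> y \<notin> W} \<union> (?B \<union> prod.swap ` ?B)"
    by (auto simp: arcs_def neighbours_def insert_commute image_iff)
  have "finite ?B" using finW finN by blast
  have "r * card V = card (arcs F)" using card_arcs_regular[OF F] by simp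
  also have "\<dots> \<le> card ({(x, y) \<in> arcs F. x \<notin> W \<and> y \<notin> W} \<union> (?B \<union> prod.swap ` ?B))"
    by (rule card_mono[OF _ sub]) (use fin \<open>finite ?B\<close> in \<open>auto intro: finite_subset[OF _ fin]\<close>)
  also have "\<dots> \<le> card {(x, y) \<in> arcs F. x \<notin> W \<and> y \<notin> W} + (card ?B + card (prod.swap ` ?B))"
    by (intro order.trans[OF card_Un_le] add_left_mono card_Un_le)
  also have "card (prod.swap ` ?B) \<le> card ?B"
    by (rule card_image_le[OF \<open>finite ?B\<close>])
  finally show ?thesis using B by simp
qed

end

section \<open>Sizes of paired lists, and matchings of the complete graph\<close>

lemma card_pairs_le: "2 * card (pairs z) \<le> length z"
proof (induction z rule: pairs.induct)
  case (1 x y zs)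
  have "card (insert {x, y} (pairs zs)) \<le> Suc (card (pairs zs))"
    by (rule card_insert_le_m1) auto
  then show ?case using 1 by simp
qed auto

lemma finite_pairs [simp]: "finite (pairs z)"
  by (induction z rule: pairs.induct) auto

lemma card_pairs_distinct: "distinct z \<Longrightarrow> even (length z) \<Longrightarrow> 2 * card (pairs z) = length z"
proof (induction z rule: pairs.induct)
  case (1 x y zs)
  then have "{x, y} \<notin> pairs zs"
    using Union_pairs[of zs] by auto
  then show ?case using 1 by simp
qed auto

lemma card_of_pairs: "distinct z \<Longrightarrow> e \<in> pairs z \<Longrightarrow> card e = 2"
  by (induction z rule: pairs.induct) auto

definition complete_edges :: "'a set \<Rightarrow> 'a set set" where
  "complete_edges V = {e. e \<subseteq> V \<and> card e = 2}"

lemma simple_complete: "finite V \<Longrightarrow> simple_graph V (complete_edges V)"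
  by (auto simp: simple_graph_def complete_edges_def)

lemma complete_perfect_matching:
  assumes "finite V" "even (card V)"
  shows "perfect_matchings V (complete_edges V) \<noteq> {}"
proof -
  obtain z where z: "set z = V" "distinct z"
    using finite_distinct_list[OF assms(1)] by blast
  then have "even (length z)" using assms(2) distinct_card by fastforce
  then have "pairs z \<in> perfect_matchings V (Pow V)"
    using pairs_perfect_matching[of z] z by simp
  then have "pairs z \<in> perfect_matchings V (complete_edges V)"
    using card_of_pairs[OF z(2)] by (auto simp: perfect_matchings_def complete_edges_def)
  then show ?thesis by blast
qed

text \<open>\<open>u\<close> is the bound for \<open>card (M - H)\<close> wherever \<open>W\<close>
  has to be avoided. As \<open>card W \<le> 2 * u\<close>, the forbidden set, with two ends and
  their partners, has at most \<open>4 + 2 * u\<close> elements.\<close>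

locale expanding_matched_graph = matched_graph V E H M D
  for V :: "'a set" and E H M :: "'a set set" and D :: nat +
  fixes \<kappa> \<tau> \<delta> \<epsilon> u :: real
  assumes kappa: "\<kappa> > 0" and tau: "real D \<ge> 2 * \<tau> * card V"
    and expander: "robust_expander \<kappa> \<tau> V H"
    and delta: "\<delta> > 0" "real D \<ge> \<delta> * card V"
    and eps: "1 / card V \<le> \<epsilon>" "\<epsilon> < 1" "path_error \<delta> \<kappa> (card V) (4 + 2 * u) \<le> \<epsilon>"
    and u: "u \<ge> 0"
begin

sublocale expanding_alternation V Nb D p \<kappa> \<tau>
proof
  show "card {v \<in> V. card (Nb v \<inter> S) \<ge> \<kappa> * card V} \<ge> card S + \<kappa> * card V"
    if "S \<subseteq> V" "\<tau> * card V \<le> card S" "card S \<le> (1 - \<tau>) * card V" for S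
    using expander that by (auto simp: robust_expander_def robust_nbhd_def)
qed (use kappa tau in auto)

definition L :: nat where
  "L = walk_length \<kappa> (card V)"

lemma card_walks_le:
  assumes "a \<in> V" "b \<in> V" "m \<ge> L"
  shows "card (alt_walks Nb p m a b) \<le> (1 + \<epsilon>) * (D ^ (m + 1) / card V)"
  using assms card_alt_walks_upper[of a b m \<epsilon>] eps by (simp add: L_def)

lemma card_paths_ge:
  assumes "a \<in> V" "b \<in> V" "m \<ge> L" "m \<le> L + 1" "finite U" "card U \<le> 4 + 2 * u"
  shows "card (alt_paths Nb p m U a b) \<ge> (1 - \<epsilon>) * (D ^ (m + 1) / card V)"
  using card_alt_paths_lower[OF assms(1,2) _ _ assms(5,6) delta eps(3)] assms(3,4)
  by (simp add: L_def)

lemma card_arcs_M: "card (arcs (M \<inter> F)) = 2 * card (M \<inter> F)"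
  by (rule card_arcs) (use finite_M simple_M in \<open>auto simp: simple_graph_def\<close>)

lemma finite_W: "finite W"
  using W_subset finite_V finite_subset by blast

lemma card_W_le: "card (M - H) \<le> u \<Longrightarrow> card W \<le> 2 * u"
  using card_W by linarith

lemma switches_from_ge:
  assumes "card (M - H) \<le> u"
  shows "card (switches_from F H (L + 1) M) \<ge> 2 * card (M \<inter> F) * ((1 - \<epsilon>) * (D ^ (L + 2) / card V))"
proof -
  have "2 * card (M \<inter> F) * ((1 - \<epsilon>) * (D ^ (L + 2) / card V))
      = (\<Sum>(x, y)\<in>arcs (M \<inter> F). (1 - \<epsilon>) * (D ^ (L + 2) / card V))"
    using card_arcs_M by (simp add: case_prod_beta)
  also have "\<dots> \<le> (\<Sum>(x, y)\<in>arcs (M \<inter> F). real (card (alt_paths Nb p (L + 1) ({x, y} \<union> W) y x)))"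
  proof (rule sum_mono, clarify)
    fix x y assume xy: "(x, y) \<in> arcs (M \<inter> F)"
    have "card ({x, y} \<union> W) \<le> card {x, y} + card W" by (rule card_Un_le)
    then have "real (card ({x, y} \<union> W)) \<le> 4 + 2 * u"
      using card_W_le[OF assms] u card_insert_le_m1[of 2 "{y}" x] by auto
    then have "(1 - \<epsilon>) * (D ^ ((L + 1) + 1) / card V) \<le> card (alt_paths Nb p (L + 1) ({x, y} \<union> W) y x)"
      using arcs_M_V[OF xy] finite_W by (intro card_paths_ge) auto
    then show "(1 - \<epsilon>) * (D ^ (L + 2) / card V) \<le> card (alt_paths Nb p (L + 1) ({x, y} \<union> W) y x)"
      by (simp add: numeral_2_eq_2)
  qed
  also have "\<dots> \<le> card (switches_from F H (L + 1) M)"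
    using card_switches_from_ge[where F = F and m = "L + 1"]
    by (simp add: case_prod_beta flip: of_nat_sum)
  finally show ?thesis .
qed

lemma switches_from_le:
  "card (switches_from F H (L + 1) M) \<le> 2 * card (M \<inter> F) * ((1 + \<epsilon>) * (D ^ (L + 2) / card V))"
proof -
  have "real (card (switches_from F H (L + 1) M))
      \<le> (\<Sum>(x, y)\<in>arcs (M \<inter> F). real (card (alt_walks Nb p (L + 1) y x)))"
    using card_switches_from_le[where F = F and m = "L + 1"]
    by (simp add: case_prod_beta flip: of_nat_sum)
  also have "\<dots> \<le> (\<Sum>(x, y)\<in>arcs (M \<inter> F). (1 + \<epsilon>) * (D ^ (L + 2) / card V))"
  proof (rule sum_mono, clarify)
    fix x y assume xy: "(x, y) \<in> arcs (M \<inter> F)"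
    show "card (alt_walks Nb p (L + 1) y x) \<le> (1 + \<epsilon>) * (D ^ (L + 2) / card V)"
      using card_walks_le[of y x "L + 1"] arcs_M_V[OF xy] by (simp add: numeral_2_eq_2)
  qed
  also have "\<dots> = 2 * card (M \<inter> F) * ((1 + \<epsilon>) * (D ^ (L + 2) / card V))"
    using card_arcs_M by (simp add: case_prod_beta)
  finally show ?thesis .
qed

lemma switches_to_le:
  assumes F: "regular_graph V F r"
  shows "card (switches_to F H (L + 1) M) \<le> r * card V * ((1 + \<epsilon>) * (D ^ (L + 1) / card V))"
proof -
  have sF: "simple_graph V F" using F by (simp add: regular_graph_def)
  have "real (card (switches_to F H (L + 1) M))
      \<le> (\<Sum>(x, y)\<in>arcs F. real (card (alt_walks Nb p L (p y) (p x))))"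
    using card_switches_to_le[OF sF, of L]
    by (simp add: case_prod_beta flip: of_nat_sum)
  also have "\<dots> \<le> (\<Sum>(x, y)\<in>arcs F. (1 + \<epsilon>) * (D ^ (L + 1) / card V))"
  proof (rule sum_mono, clarify)
    fix x y assume xy: "(x, y) \<in> arcs F"
    then have "p x \<in> V" "p y \<in> V" using simple_graph_edge[OF sF] partner by (auto simp: arcs_def)
    then show "card (alt_walks Nb p L (p y) (p x)) \<le> (1 + \<epsilon>) * (D ^ (L + 1) / card V)"
      by (intro card_walks_le) auto
  qed
  also have "\<dots> = r * card V * ((1 + \<epsilon>) * (D ^ (L + 1) / card V))"
    by (simp add: case_prod_beta card_arcs_regular[OF F])
  finally show ?thesis .
qed

text \<open>Arcs of \<open>F\<close> that meet \<open>W\<close> are discarded, at most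
  \<open>2 * r * card W \<le> 4 * r * u\<close> of them.\<close>

lemma switches_to_ge:
  assumes F: "regular_graph V F r" and FH: "F \<inter> H = {}" and MH: "card (M - H) \<le> u"
  shows "card (switches_to F H (L + 1) M) \<ge>
    (r * card V - 4 * r * u) * ((1 - \<epsilon>) * (D ^ (L + 1) / card V))"
proof -
  have sF: "simple_graph V F" using F by (simp add: regular_graph_def)
  let ?R = "{(x, y) \<in> arcs F. x \<notin> W \<and> y \<notin> W}"
  have "r * card V \<le> real (card ?R) + 2 * r * card W"
    using of_nat_mono[OF card_arcs_avoiding[OF F], where 'a = real] by simp
  moreover have "2 * real r * card W \<le> 2 * real r * (2 * u)"
    using card_W_le[OF MH] by (intro mult_left_mono) auto
  ultimately have R: "r * card V - 4 * r * u \<le> real (card ?R)"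
    by (simp add: algebra_simps)
  have "(r * card V - 4 * r * u) * ((1 - \<epsilon>) * (D ^ (L + 1) / card V))
      \<le> card ?R * ((1 - \<epsilon>) * (D ^ (L + 1) / card V))"
    using R eps by (intro mult_right_mono) auto
  also have "\<dots> = (\<Sum>(x, y)\<in>?R. (1 - \<epsilon>) * (D ^ (L + 1) / card V))"
    by (simp add: case_prod_beta)
  also have "\<dots> \<le> (\<Sum>(x, y)\<in>?R. real (card (alt_paths Nb p L ({x, y, p x, p y} \<union> W) (p y) (p x))))"
  proof (rule sum_mono, clarify)
    fix x y assume xy: "(x, y) \<in> arcs F"
    then have V: "p x \<in> V" "p y \<in> V" using simple_graph_edge[OF sF] partner by (auto simp: arcs_def)
    have "card ({x, y, p x, p y} \<union> W) \<le> card {x, y, p x, p y} + card W" by (rule card_Un_le)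
    moreover have "card {x, y, p x, p y} \<le> 4"
      using card_length[of "[x, y, p x, p y]"] by simp
    ultimately have "real (card ({x, y, p x, p y} \<union> W)) \<le> 4 + 2 * u"
      using card_W_le[OF MH] by linarith
    then show "(1 - \<epsilon>) * (D ^ (L + 1) / card V) \<le> card (alt_paths Nb p L ({x, y, p x, p y} \<union> W) (p y) (p x))"
      using V finite_W by (intro card_paths_ge) auto
  qed
  also have "\<dots> \<le> card (switches_to F H (L + 1) M)"
    using card_switches_to_ge[OF sF FH, of L]
    by (simp add: case_prod_beta flip: of_nat_sum)
  finally show ?thesis by (simp only: of_nat_mult of_nat_numeral)
qed

text \<open>The path avoids only the ends of an edge of \<open>M\<close> outside \<open>H\<close>,
  so it exists however many such edges there are. All \<open>L + 1\<close> new edges lie in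
  \<open>H\<close>, but at most \<open>L\<close> of the old ones do.\<close>

lemma improve_matching:
  assumes "\<not> M \<subseteq> H" "H \<subseteq> E"
  shows "\<exists>M'. M' \<in> perfect_matchings V E \<and> card (M \<inter> H) < card (M' \<inter> H)"
proof -
  obtain e where e: "e \<in> M" "e \<notin> H" using assms by blast
  then have "card e = 2" using simple_M by (auto simp: simple_graph_def)
  then obtain x y where xy: "e = {x, y}" "x \<noteq> y" by (auto simp: card_2_iff)
  have V: "x \<in> V" "y \<in> V" "p x = y" "p y = x" using edge_M e xy by auto
  have cV: "card V > 0" using V finite_V card_gt_0_iff by blast
  have "real (card {x, y}) \<le> 4 + 2 * u" using xy u by simp
  then have "card (alt_paths Nb p L {x, y} y x) \<ge> (1 - \<epsilon>) * (D ^ (L + 1) / card V)"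
    using V by (intro card_paths_ge) auto
  moreover have "(1 - \<epsilon>) * (D ^ (L + 1) / card V) > 0"
    using eps D cV by simp
  ultimately have "real (card (alt_paths Nb p L {x, y} y x)) > 0" by linarith
  then have "alt_paths Nb p L {x, y} y x \<noteq> {}"
    by auto
  then obtain us where us: "length us = L" "alt_path Nb p x {x, y} y us"
    by (auto simp: alt_paths_def)
  have d: "distinct (interleave p us) \<and> set (interleave p us) \<inter> {x, y} = {}"
    by (rule alt_path_interleave[OF us(2)]) (use V in auto)
  let ?A = "pairs (x # y # interleave p us)" and ?B = "pairs (y # interleave p us @ [x])"
  let ?S = "set (x # y # interleave p us)"
  have AS: "?A \<in> perfect_matchings ?S (Pow ?S)"
    by (rule pairs_perfect_matching) (use d xy in auto)
  have "?B \<in> perfect_matchings (set (y # interleave p us @ [x])) (Pow (set (y # interleave p us @ [x])))"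
    by (rule pairs_perfect_matching) (use d xy in auto)
  moreover have "set (y # interleave p us @ [x]) = ?S" by auto
  ultimately have BS: "?B \<in> perfect_matchings ?S (Pow ?S)" by simp
  have AM: "?A \<subseteq> M"
    using e xy pairs_interleave[OF alt_path_set[OF us(2)]] by simp
  have BH: "?B \<subseteq> H"
    by (rule alt_walk_pairs[OF alt_path_imp_alt_walk[OF us(2)]])
  have "\<Union> ?A = ?S" by (rule Union_pairs) simp
  moreover have "\<Union> ?A \<subseteq> V"
    using AM simple_M unfolding simple_graph_def by (intro Union_least) blast
  ultimately have SV: "?S \<subseteq> V" by (simp only:)
  have pm: "exchange ?A ?B M \<in> perfect_matchings V E"
    by (rule exchange_perfect_matching[OF M AM _ AS BS SV]) (use BH assms in auto)
  have "card (exchange ?A ?B M \<inter> H) + card (?A \<inter> H) = card (M \<inter> H) + card (?B \<inter> H)"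
    using disjoint_exchange[OF M AM E _ AS BS SV] BH assms(2)
    by (intro card_exchange[OF finite_M _ AM]) auto
  moreover have "card (?B \<inter> H) = L + 1"
  proof -
    have "2 * card ?B = length (y # interleave p us @ [x])"
      by (rule card_pairs_distinct) (use d xy in auto)
    then show ?thesis using BH us(1) by (simp add: Int_absorb2)
  qed
  moreover have "card (?A \<inter> H) \<le> L"
  proof -
    have "?A \<inter> H \<subseteq> pairs (interleave p us)" using e xy by auto
    then have "card (?A \<inter> H) \<le> card (pairs (interleave p us))" by (intro card_mono) auto
    then show ?thesis using card_pairs_le[of "interleave p us"] us(1) by simp
  qed
  ultimately show ?thesis using pm by (intro exI[of _ "exchange ?A ?B M"]) auto
qed

end

subsection \<open>Comparing the numbers of matchings with given overlap\<close>

text \<open>Serves both the deletion of \<open>F\<close>, at the price of half the constant, and the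
  passage from \<open>E - F\<close> back to \<open>E\<close>.\<close>

lemma robust_expander_mono:
  assumes "robust_expander \<nu> \<tau> V H" "\<kappa> \<ge> 0" "\<kappa> \<le> \<nu>" "finite V"
    and "\<And>v S. v \<in> V \<Longrightarrow> S \<subseteq> V \<Longrightarrow> \<nu> * card V \<le> card (neighbours H v \<inter> S) \<Longrightarrow>
      \<kappa> * card V \<le> card (neighbours G v \<inter> S)"
  shows "robust_expander \<kappa> \<tau> V G"
  unfolding robust_expander_def
proof (intro allI impI)
  fix S assume S: "S \<subseteq> V" "\<tau> * card V \<le> card S \<and> card S \<le> (1 - \<tau>) * card V"
  have "card S + \<kappa> * card V \<le> card S + \<nu> * card V"
    using assms(3) by (simp add: mult_right_mono)
  also have "\<dots> \<le> card (robust_nbhd \<nu> V H S)"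
    using assms(1) S by (auto simp: robust_expander_def)
  also have "card (robust_nbhd \<nu> V H S) \<le> card (robust_nbhd \<kappa> V G S)"
    by (rule card_mono) (use assms(4,5) S(1) in \<open>auto simp: robust_nbhd_def\<close>)
  finally show "card S + \<kappa> * card V \<le> card (robust_nbhd \<kappa> V G S)" by simp
qed

lemma neighbours_Diff: "neighbours (E - F) v = neighbours E v - neighbours F v"
  by (auto simp: neighbours_def)

lemma finite_neighbours: "simple_graph V A \<Longrightarrow> finite (neighbours A v)"
  using neighbours_subset finite_subset by (metis simple_graph_def)

lemma regular_graph_Diff:
  assumes "regular_graph V E d" "regular_graph V F r" "F \<subseteq> E"
  shows "regular_graph V (E - F) (d - r)"
proof -
  have "simple_graph V (E - F)" using assms by (auto simp: regular_graph_def simple_graph_def)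
  moreover have "card (neighbours (E - F) v) = d - r" if "v \<in> V" for v
  proof -
    have "neighbours F v \<subseteq> neighbours E v" using assms(3) by (auto simp: neighbours_def)
    moreover have "finite (neighbours F v)"
      using assms(2) by (intro finite_neighbours) (auto simp: regular_graph_def)
    ultimately show ?thesis
      using assms that by (simp add: neighbours_Diff card_Diff_subset regular_graph_def)
  qed
  ultimately show ?thesis by (simp add: regular_graph_def)
qed

section \<open>Numbers of perfect matchings by overlap with \<open>F\<close>\<close>

locale switching_setup =
  fixes V :: "'a set" and E F :: "'a set set" and d r :: nat and \<kappa> \<tau> \<delta> \<epsilon> u :: real
  assumes GE: "regular_graph V E d" and GF: "regular_graph V F r" and sub: "F \<subseteq> E"
    and nonempty: "V \<noteq> {}" and even: "even (card V)"
    and kappa: "\<kappa> > 0" and tau: "real d - real r \<ge> 2 * \<tau> * card V"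
    and expander: "robust_expander \<kappa> \<tau> V (E - F)"
    and delta: "\<delta> > 0" "real d - real r \<ge> \<delta> * card V"
    and eps: "1 / card V \<le> \<epsilon>" "\<epsilon> < 1" "path_error \<delta> \<kappa> (card V) (4 + 2 * u) \<le> \<epsilon>"
    and u: "u \<ge> 0"
begin

definition D :: nat where "D = d - r"
definition l :: nat where "l = walk_length \<kappa> (card V)"
definition H :: "'a set set" where "H = E - F"
definition count :: "nat \<Rightarrow> nat" where
  "count k = card {M \<in> perfect_matchings V E. card (M \<inter> F) = k}"

lemma simple_E: "simple_graph V E"
  using GE by (simp add: regular_graph_def)

lemma finite_V: "finite V"
  using simple_E by (simp add: simple_graph_def)

lemma n_pos: "card V > 0"
  using finite_V nonempty by (simp add: card_gt_0_iff)

lemma r_less: "r < d"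
proof -
  have "\<delta> * card V > 0" using delta n_pos by simp
  then show ?thesis using delta(2) by linarith
qed

lemma D_eq: "real D = real d - real r" and D_pos: "D > 0"
  using r_less by (simp_all add: D_def of_nat_diff)

lemma H_expanding:
  assumes "M \<in> perfect_matchings V E"
  shows "expanding_matched_graph V E H M D \<kappa> \<tau> \<delta> \<epsilon> u"
  using assms simple_E D_pos kappa tau expander delta eps u regular_graph_Diff[OF GE GF sub]
  by unfold_locales (auto simp: H_def D_def[symmetric] D_eq)

text \<open>Obtained from \<open>E - F\<close>, so that walks in both graphs share
  \<open>\<kappa>\<close> and therefore their length.\<close>

lemma expander_E: "robust_expander \<kappa> \<tau> V E"
proof (rule robust_expander_mono[OF expander _ _ finite_V])
  fix v S assume "\<kappa> * card V \<le> card (neighbours (E - F) v \<inter> S)"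
  also have "card (neighbours (E - F) v \<inter> S) \<le> card (neighbours E v \<inter> S)"
    using finite_neighbours[OF simple_E] by (intro card_mono) (auto simp: neighbours_def)
  finally show "\<kappa> * card V \<le> card (neighbours E v \<inter> S)" by simp
qed (use kappa in auto)

lemma E_expanding:
  assumes "simple_graph V E'" "M \<in> perfect_matchings V E'"
  shows "expanding_matched_graph V E' E M d \<kappa> \<tau> \<delta> \<epsilon> u"
  using assms GE r_less kappa tau expander_E delta eps u
  by unfold_locales auto

text \<open>A perfect matching of the complete graph with as many edges in \<open>E\<close> as
  possible lies in \<open>E\<close>, as \<open>improve_matching\<close> would otherwise apply. This
  gives the uniform law on perfect matchings its meaning.\<close>

lemma perfect_matching_exists: "perfect_matchings V E \<noteq> {}"
proof -
  let ?K = "complete_edges V"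
  let ?f = "\<lambda>M. card (M \<inter> E)"
  have K: "simple_graph V ?K" using simple_complete[OF finite_V] .
  have EK: "E \<subseteq> ?K" using simple_E by (auto simp: complete_edges_def simple_graph_def)
  have fin: "finite (perfect_matchings V ?K)" using finite_perfect_matchings[OF K] .
  have ne: "perfect_matchings V ?K \<noteq> {}" using complete_perfect_matching[OF finite_V even] .
  have "Max (?f ` perfect_matchings V ?K) \<in> ?f ` perfect_matchings V ?K"
    using fin ne by (intro Max_in) auto
  then obtain M where M: "M \<in> perfect_matchings V ?K" "?f M = Max (?f ` perfect_matchings V ?K)"
    by force
  have "M \<subseteq> E"
  proof (rule ccontr)
    assume "\<not> M \<subseteq> E"
    then obtain M' where M': "M' \<in> perfect_matchings V ?K" "?f M < ?f M'"
      using expanding_matched_graph.improve_matching[OF E_expanding[OF K M(1)] _ EK] by blast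
    have "?f M' \<le> Max (?f ` perfect_matchings V ?K)" using fin M'(1) by (intro Max_ge) auto
    then show False using M' M by simp
  qed
  then have "M \<in> perfect_matchings V E" using M by (auto simp: perfect_matchings_def)
  then show ?thesis by blast
qed

text \<open>A switch removes the edge \<open>{x, y}\<close> of \<open>F\<close>; its other old edges
  and all new ones lie in \<open>E - F\<close>, so the overlap drops by exactly one.\<close>

lemma switch_count:
  "(\<Sum>M | M \<in> perfect_matchings V E \<and> card (M \<inter> F) = Suc k. card (switches_from F H m M)) =
    (\<Sum>M | M \<in> perfect_matchings V E \<and> card (M \<inter> F) = k. card (switches_to F H m M))"
proof (rule switches_double_count[OF simple_E sub])
  show "H \<subseteq> E" by (auto simp: H_def)
  fix z M assume z: "z \<in> switches F H m" and M: "M \<in> perfect_matchings V E" "old_edges z \<subseteq> M"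
    "(M - old_edges z) \<inter> new_edges z = {}"
  obtain x y zs where xyz: "z = (x, y, zs)" by (cases z)
  note zz = z[unfolded xyz]
  have new: "new_edges z \<subseteq> H" using new_edges_subset[OF zz] xyz by simp
  have old: "old_edges z \<inter> F = {{x, y}}"
    using old_edges_subset[OF zz] unfolding xyz H_def by blast
  have "finite M"
    using M(1) finite_simple_graph[OF simple_E] finite_subset by (auto simp: perfect_matchings_def)
  moreover have "finite (new_edges z)"
    using new finite_subset[OF _ finite_simple_graph[OF simple_E]] by (auto simp: H_def)
  ultimately have "card (exchange (old_edges z) (new_edges z) M \<inter> F) + card (old_edges z \<inter> F)
      = card (M \<inter> F) + card (new_edges z \<inter> F)"
    using M by (intro card_exchange)
  moreover have "new_edges z \<inter> F = {}" using new by (auto simp: H_def)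
  ultimately show "card (M \<inter> F) = Suc k \<longleftrightarrow> card (exchange (old_edges z) (new_edges z) M \<inter> F) = k"
    using old by auto
qed

lemma Diff_H: "M \<in> perfect_matchings V E \<Longrightarrow> M - H = M \<inter> F"
  by (auto simp: H_def perfect_matchings_def)

text \<open>Compares a lower bound for the switches out of overlap \<open>Suc k\<close> with an
  upper bound for those into overlap \<open>k\<close>. By \<open>Diff_H\<close> the overlap is
  \<open>card (M - H)\<close>, so the assumption keeps \<open>W\<close> small.\<close>

lemma count_upper:
  assumes "real (Suc k) \<le> u"
  shows "count (Suc k) * (2 * real (Suc k)) * (1 - \<epsilon>) * D \<le> count k * (real r * card V) * (1 + \<epsilon>)"
proof -
  let ?P = "\<lambda>k. {M. M \<in> perfect_matchings V E \<and> card (M \<inter> F) = k}"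
  let ?x = "real D ^ (l + 1) / card V"
  have x: "?x > 0" using D_pos n_pos by simp
  have x': "real D ^ (l + 2) / card V = D * ?x" by simp
  have "count (Suc k) * (2 * real (Suc k) * ((1 - \<epsilon>) * (D ^ (l + 2) / card V)))
      = (\<Sum>M\<in>?P (Suc k). 2 * real (Suc k) * ((1 - \<epsilon>) * (D ^ (l + 2) / card V)))"
    by (simp add: count_def)
  also have "\<dots> \<le> (\<Sum>M\<in>?P (Suc k). real (card (switches_from F H (l + 1) M)))"
  proof (rule sum_mono)
    fix M assume MP: "M \<in> ?P (Suc k)"
    interpret expanding_matched_graph V E H M D \<kappa> \<tau> \<delta> \<epsilon> u using MP by (intro H_expanding) auto
    show "2 * real (Suc k) * ((1 - \<epsilon>) * (D ^ (l + 2) / card V)) \<le> card (switches_from F H (l + 1) M)"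
    proof -
      have c: "card (M \<inter> F) = Suc k" and MH: "real (card (M - H)) \<le> u"
        using MP Diff_H[of M] assms by simp_all
      show ?thesis
        using switches_from_ge[of F, OF MH] c by (simp add: L_def l_def)
    qed
  qed
  also have "\<dots> = (\<Sum>M\<in>?P k. real (card (switches_to F H (l + 1) M)))"
    using switch_count[where m = "l + 1" and k = k] by (simp flip: of_nat_sum)
  also have "\<dots> \<le> (\<Sum>M\<in>?P k. r * card V * ((1 + \<epsilon>) * (D ^ (l + 1) / card V)))"
  proof (rule sum_mono)
    fix M assume MP: "M \<in> ?P k"
    interpret expanding_matched_graph V E H M D \<kappa> \<tau> \<delta> \<epsilon> u using MP by (intro H_expanding) auto
    show "card (switches_to F H (l + 1) M) \<le> r * card V * ((1 + \<epsilon>) * (D ^ (l + 1) / card V))"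
      using switches_to_le[OF GF] by (simp add: L_def l_def)
  qed
  also have "\<dots> = count k * (r * card V * ((1 + \<epsilon>) * (D ^ (l + 1) / card V)))"
    by (simp add: count_def)
  finally have "(count (Suc k) * (2 * real (Suc k)) * (1 - \<epsilon>) * D) * ?x
      \<le> (count k * (real r * card V) * (1 + \<epsilon>)) * ?x"
    unfolding x' of_nat_power of_nat_mult by (simp only: mult_ac)
  then show ?thesis using x by (simp only: mult_le_cancel_right_pos)
qed

lemma count_lower:
  assumes "real (Suc k) \<le> u"
  shows "count k * (real r * card V - 4 * r * u) * (1 - \<epsilon>)
    \<le> count (Suc k) * (2 * real (Suc k)) * (1 + \<epsilon>) * D"
proof -
  let ?P = "\<lambda>k. {M. M \<in> perfect_matchings V E \<and> card (M \<inter> F) = k}"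
  let ?x = "real D ^ (l + 1) / card V"
  have x: "?x > 0" using D_pos n_pos by simp
  have x': "real D ^ (l + 2) / card V = D * ?x" by simp
  have "count k * ((r * card V - 4 * r * u) * ((1 - \<epsilon>) * (D ^ (l + 1) / card V)))
      = (\<Sum>M\<in>?P k. (r * card V - 4 * r * u) * ((1 - \<epsilon>) * (D ^ (l + 1) / card V)))"
    by (simp add: count_def)
  also have "\<dots> \<le> (\<Sum>M\<in>?P k. real (card (switches_to F H (l + 1) M)))"
  proof (rule sum_mono)
    fix M assume MP: "M \<in> ?P k"
    interpret expanding_matched_graph V E H M D \<kappa> \<tau> \<delta> \<epsilon> u using MP by (intro H_expanding) auto
    show "(r * card V - 4 * r * u) * ((1 - \<epsilon>) * (D ^ (l + 1) / card V))
        \<le> card (switches_to F H (l + 1) M)"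
    proof -
      have MH: "real (card (M - H)) \<le> u" and FH: "F \<inter> H = {}"
        using MP Diff_H[of M] assms by (simp_all add: H_def)
      show ?thesis
        using switches_to_ge[OF GF FH MH] by (simp add: L_def l_def)
    qed
  qed
  also have "\<dots> = (\<Sum>M\<in>?P (Suc k). real (card (switches_from F H (l + 1) M)))"
    using switch_count[where m = "l + 1" and k = k] by (simp flip: of_nat_sum)
  also have "\<dots> \<le> (\<Sum>M\<in>?P (Suc k). 2 * real (Suc k) * ((1 + \<epsilon>) * (D ^ (l + 2) / card V)))"
  proof (rule sum_mono)
    fix M assume MP: "M \<in> ?P (Suc k)"
    interpret expanding_matched_graph V E H M D \<kappa> \<tau> \<delta> \<epsilon> u using MP by (intro H_expanding) auto
    show "card (switches_from F H (l + 1) M) \<le> 2 * real (Suc k) * ((1 + \<epsilon>) * (D ^ (l + 2) / card V))"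
      using switches_from_le[of F] MP by (simp add: L_def l_def)
  qed
  also have "\<dots> = count (Suc k) * (2 * real (Suc k) * ((1 + \<epsilon>) * (D ^ (l + 2) / card V)))"
    by (simp add: count_def)
  finally have "(count k * (real r * card V - 4 * r * u) * (1 - \<epsilon>)) * ?x
      \<le> (count (Suc k) * (2 * real (Suc k)) * (1 + \<epsilon>) * D) * ?x"
    unfolding x' of_nat_power of_nat_mult by (simp only: mult_ac)
  then show ?thesis using x by (simp only: mult_le_cancel_right_pos)
qed

text \<open>With \<open>E\<close> in the role of \<open>H\<close> the set \<open>W\<close> is empty,
  so matchings of every overlap are covered. A switch may now change the overlap by any amount,
  which is harmless since the sums run over all perfect matchings.\<close>

lemma sum_overlap_le:
  "(\<Sum>M\<in>perfect_matchings V E. real (card (M \<inter> F))) * 2 * (1 - \<epsilon>) * d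
    \<le> card (perfect_matchings V E) * (real r * card V) * (1 + \<epsilon>)"
proof -
  let ?P = "perfect_matchings V E"
  let ?x = "real d ^ (l + 1) / card V"
  have x: "?x > 0" using r_less n_pos by simp
  have x': "real d ^ (l + 2) / card V = d * ?x" by simp
  have factor: "(\<Sum>M\<in>?P. 2 * real (card (M \<inter> F)) * c) = 2 * (\<Sum>M\<in>?P. real (card (M \<inter> F))) * c"
    for c by (simp add: sum_distrib_left sum_distrib_right)
  have dc: "(\<Sum>M\<in>?P. card (switches_from F E (l + 1) M)) = (\<Sum>M\<in>?P. card (switches_to F E (l + 1) M))"
    using switches_double_count[OF simple_E sub order_refl, of "l + 1" "\<lambda>_. True" "\<lambda>_. True"] by simp
  have "(\<Sum>M\<in>?P. 2 * real (card (M \<inter> F)) * ((1 - \<epsilon>) * (d ^ (l + 2) / card V)))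
      \<le> (\<Sum>M\<in>?P. real (card (switches_from F E (l + 1) M)))"
  proof (rule sum_mono)
    fix M assume MP: "M \<in> ?P"
    interpret expanding_matched_graph V E E M d \<kappa> \<tau> \<delta> \<epsilon> u using MP by (intro E_expanding simple_E)
    have "M - E = {}" using MP by (auto simp: perfect_matchings_def)
    have "real (card (M - E)) \<le> u" unfolding \<open>M - E = {}\<close> using u by simp
    then show "2 * real (card (M \<inter> F)) * ((1 - \<epsilon>) * (d ^ (l + 2) / card V))
        \<le> card (switches_from F E (l + 1) M)"
      using switches_from_ge[of F] by (simp add: L_def l_def)
  qed
  also have "\<dots> = (\<Sum>M\<in>?P. real (card (switches_to F E (l + 1) M)))"
    using dc by (simp flip: of_nat_sum)
  also have "\<dots> \<le> (\<Sum>M\<in>?P. r * card V * ((1 + \<epsilon>) * (d ^ (l + 1) / card V)))"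
  proof (rule sum_mono)
    fix M assume MP: "M \<in> ?P"
    interpret expanding_matched_graph V E E M d \<kappa> \<tau> \<delta> \<epsilon> u using MP by (intro E_expanding simple_E)
    show "card (switches_to F E (l + 1) M) \<le> r * card V * ((1 + \<epsilon>) * (d ^ (l + 1) / card V))"
      using switches_to_le[OF GF] by (simp add: L_def l_def)
  qed
  also have "\<dots> = card ?P * (r * card V * ((1 + \<epsilon>) * (d ^ (l + 1) / card V)))"
    by simp
  finally have "((\<Sum>M\<in>?P. real (card (M \<inter> F))) * 2 * (1 - \<epsilon>) * d) * ?x
      \<le> (card ?P * (real r * card V) * (1 + \<epsilon>)) * ?x"
    unfolding x' of_nat_power of_nat_mult factor by (simp only: mult_ac)
  then show ?thesis using x by (simp only: mult_le_cancel_right_pos)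
qed

end

subsection \<open>Poisson approximation\<close>

lemma pmf_summable_on: "pmf p summable_on A"
  using pmf_abs_summable[of p A] abs_summable_equivalent[of "pmf p" A] abs_summable_summable by blast

lemma measure_pmf_conv_infsum: "measure (measure_pmf p) A = infsum (pmf p) A"
  using measure_pmf_conv_infsetsum infsetsum_infsum[OF pmf_abs_summable] by metis

lemma infsum_pmf_UNIV: "infsum (pmf p) UNIV = 1"
  using measure_pmf_conv_infsum[of p UNIV] by simp

text \<open>Since both laws have total mass \<open>1\<close>, the distance is the sum of the positive parts of
  \<open>pmf q k - pmf p k\<close> alone.\<close>

lemma d_TV_le:
  assumes \<beta>: "\<beta> \<ge> 0" and A: "\<And>k. k \<in> A \<Longrightarrow> pmf p k \<ge> (1 - \<beta>) * pmf q k"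
  shows "d_TV p q \<le> \<beta> + measure (measure_pmf q) (- A)"
proof -
  define g where "g k = (if k \<in> - A then pmf q k else 0)" for k
  have g_sum: "g summable_on UNIV"
    by (rule summable_on_comparison_test[OF pmf_summable_on[of q]]) (auto simp: g_def)
  have g_inf: "infsum g UNIV = measure (measure_pmf q) (- A)"
    unfolding measure_pmf_conv_infsum by (rule infsum_cong_neutral) (auto simp: g_def)
  have s: "(\<lambda>k. 2 * (\<beta> * pmf q k) + 2 * g k) summable_on UNIV"
    by (intro summable_on_add summable_on_cmult_right pmf_summable_on g_sum)
  have s': "(\<lambda>k. pmf p k + - 1 * pmf q k) summable_on UNIV"
    by (intro summable_on_add summable_on_cmult_right pmf_summable_on)
  have le: "\<bar>pmf p k - pmf q k\<bar> \<le> (2 * (\<beta> * pmf q k) + 2 * g k) + (pmf p k + - 1 * pmf q k)" for k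
  proof (cases "k \<in> A")
    case True
    have "\<beta> * pmf q k \<ge> 0" using \<beta> by simp
    then show ?thesis using A[OF True] True by (simp add: g_def algebra_simps)
  next
    case False
    have "\<beta> * pmf q k \<ge> 0" using \<beta> by simp
    moreover have "g k = pmf q k" using False by (simp add: g_def)
    ultimately show ?thesis using pmf_nonneg[of p k] pmf_nonneg[of q k] by linarith
  qed
  have "(\<lambda>k. \<bar>pmf p k - pmf q k\<bar>) summable_on UNIV"
    by (rule summable_on_comparison_test[OF summable_on_add[OF s s']]) (use le in auto)
  then have "(\<Sum>\<^sub>\<infinity>k. \<bar>pmf p k - pmf q k\<bar>) \<le>
      (\<Sum>\<^sub>\<infinity>k. (2 * (\<beta> * pmf q k) + 2 * g k) + (pmf p k + - 1 * pmf q k))"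
    by (rule infsum_mono[OF _ summable_on_add[OF s s']]) (rule le)
  also have "\<dots> = (\<Sum>\<^sub>\<infinity>k. 2 * (\<beta> * pmf q k) + 2 * g k) + (\<Sum>\<^sub>\<infinity>k. pmf p k + - 1 * pmf q k)"
    by (rule infsum_add[OF s s'])
  also have "(\<Sum>\<^sub>\<infinity>k. 2 * (\<beta> * pmf q k) + 2 * g k) = 2 * (\<beta> * 1) + 2 * infsum g UNIV"
    by (subst infsum_add) (auto intro!: summable_on_cmult_right pmf_summable_on g_sum
        simp: infsum_cmult_right' infsum_pmf_UNIV)
  also have "(\<Sum>\<^sub>\<infinity>k. pmf p k + - 1 * pmf q k) = 0"
    unfolding infsum_add[OF pmf_summable_on summable_on_cmult_right[OF pmf_summable_on]]
      infsum_cmult_right' infsum_pmf_UNIV by simp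
  finally show ?thesis
    unfolding d_TV_def g_inf by simp
qed

text \<open>By the ratio of consecutive Poisson weights, the mass beyond \<open>K\<close> is at most
  \<open>\<mu> / Suc K\<close> times the mass from \<open>K\<close> on.\<close>

lemma poisson_tail:
  assumes "\<mu> > 0"
  shows "measure (measure_pmf (poisson_pmf \<mu>)) {Suc K..} \<le> \<mu> / Suc K"
proof -
  let ?q = "pmf (poisson_pmf \<mu>)"
  have step: "?q (Suc k) \<le> \<mu> / Suc K * ?q k" if "k \<in> {K..}" for k
  proof -
    have "?q (Suc k) = \<mu> / Suc k * ?q k"
      using assms by simp
    also have "\<dots> \<le> \<mu> / Suc K * ?q k"
      using that assms by (intro mult_right_mono divide_left_mono) auto
    finally show ?thesis .
  qed
  have "bij_betw Suc {K..} {Suc K..}"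
    by (rule bij_betwI[of _ _ _ "\<lambda>k. k - 1"]) auto
  then have "measure (measure_pmf (poisson_pmf \<mu>)) {Suc K..} = (\<Sum>\<^sub>\<infinity>k\<in>{K..}. ?q (Suc k))"
    unfolding measure_pmf_conv_infsum by (rule infsum_reindex_bij_betw[symmetric])
  also have "\<dots> \<le> (\<Sum>\<^sub>\<infinity>k\<in>{K..}. \<mu> / Suc K * ?q k)"
  proof (rule infsum_mono[OF _ summable_on_cmult_right[OF pmf_summable_on] step])
    show "(\<lambda>k. ?q (Suc k)) summable_on {K..}"
      by (rule summable_on_comparison_test[OF summable_on_cmult_right[OF pmf_summable_on] step])
        auto
  qed
  also have "\<dots> = \<mu> / Suc K * measure (measure_pmf (poisson_pmf \<mu>)) {K..}"
    unfolding measure_pmf_conv_infsum by (rule infsum_cmult_right')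
  also have "\<dots> \<le> \<mu> / Suc K * 1"
    using assms by (intro mult_left_mono measure_pmf.prob_le_1) auto
  finally show ?thesis by simp
qed

lemma sum_le_exp: "x \<ge> 0 \<Longrightarrow> (\<Sum>k\<le>K. x ^ k / fact k) \<le> exp (x :: real)"
  using sum_le_suminf[OF summable_exp_generic[of x], of "{..K}"]
  by (simp add: exp_def divide_inverse mult.commute)

text \<open>The upper ratios and the total mass force
  \<open>a 0 * (1 + e) ^ K * exp \<mu> \<ge> 1 - t\<close>; the lower ratios bound
  \<open>a k\<close> below by \<open>a 0 * (1 - e) ^ K\<close> times
  \<open>\<mu> ^ k / fact k\<close>. The quotient of the two powers costs
  \<open>2 * K * e\<close>.\<close>

lemma poisson_lower_bound_of_ratios:
  fixes a :: "nat \<Rightarrow> real"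
  assumes \<mu>: "\<mu> > 0" and e: "0 \<le> e" "e \<le> 1" and a: "\<And>k. a k \<ge> 0"
    and lo: "\<And>k. k < K \<Longrightarrow> (1 - e) * \<mu> * a k \<le> Suc k * a (Suc k)"
    and hi: "\<And>k. k < K \<Longrightarrow> Suc k * a (Suc k) \<le> (1 + e) * \<mu> * a k"
    and mass: "(\<Sum>k\<le>K. a k) \<ge> 1 - t" and t: "t \<ge> 0" and k: "k \<le> K"
  shows "a k \<ge> (1 - (t + 2 * real K * e)) * (\<mu> ^ k / fact k * exp (- \<mu>))"
proof (cases "t \<le> 1")
  \<comment> \<open>For \<open>t > 1\<close> the claimed lower bound is nonpositive.\<close>
  case False
  moreover have "2 * real K * e \<ge> 0" using e by simp
  ultimately have "1 - (t + 2 * real K * e) \<le> 0" by linarith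
  then have "(1 - (t + 2 * real K * e)) * (\<mu> ^ k / fact k * exp (- \<mu>)) \<le> 0"
    using \<mu> by (intro mult_nonpos_nonneg) auto
  then show ?thesis using a[of k] by linarith
next
  case True
  have lower: "a 0 * (1 - e) ^ K * (\<mu> ^ j / fact j) \<le> a j" if "j \<le> K" for j
  proof -
    have "a 0 * (1 - e) ^ j * (\<mu> ^ j / fact j) \<le> a j"
      using that
    proof (induction j)
      case (Suc j)
      have "Suc j * (a 0 * (1 - e) ^ Suc j * (\<mu> ^ Suc j / fact (Suc j)))
          = (1 - e) * \<mu> * (a 0 * (1 - e) ^ j * (\<mu> ^ j / fact j))"
        by (simp add: divide_simps)
      also have "\<dots> \<le> (1 - e) * \<mu> * a j"
        using Suc \<mu> e by (intro mult_left_mono) auto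
      also have "\<dots> \<le> Suc j * a (Suc j)"
        using lo[of j] Suc.prems by simp
      finally show ?case by (simp only: mult_le_cancel_left_pos of_nat_0_less_iff zero_less_Suc)
    qed simp
    moreover have "a 0 * (1 - e) ^ K * (\<mu> ^ j / fact j) \<le> a 0 * (1 - e) ^ j * (\<mu> ^ j / fact j)"
      using e that a[of 0] \<mu> by (intro mult_right_mono mult_left_mono power_decreasing) auto
    ultimately show ?thesis by linarith
  qed
  have upper: "a j \<le> a 0 * (1 + e) ^ K * (\<mu> ^ j / fact j)" if "j \<le> K" for j
  proof -
    have "a j \<le> a 0 * (1 + e) ^ j * (\<mu> ^ j / fact j)"
      using that
    proof (induction j)
      case (Suc j)
      have "Suc j * a (Suc j) \<le> (1 + e) * \<mu> * a j"
        using hi[of j] Suc.prems by simp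
      also have "\<dots> \<le> (1 + e) * \<mu> * (a 0 * (1 + e) ^ j * (\<mu> ^ j / fact j))"
        using Suc \<mu> e by (intro mult_left_mono) auto
      also have "\<dots> = Suc j * (a 0 * (1 + e) ^ Suc j * (\<mu> ^ Suc j / fact (Suc j)))"
        by (simp add: divide_simps)
      finally show ?case by (simp only: mult_le_cancel_left_pos of_nat_0_less_iff zero_less_Suc)
    qed simp
    moreover have "a 0 * (1 + e) ^ j * (\<mu> ^ j / fact j) \<le> a 0 * (1 + e) ^ K * (\<mu> ^ j / fact j)"
      using e that a[of 0] \<mu> by (intro mult_right_mono mult_left_mono power_increasing) auto
    ultimately show ?thesis by linarith
  qed
  define x where "x = a 0 * (1 + e) ^ K * exp \<mu>"
  define \<rho> where "\<rho> = (1 - e) / (1 + e)"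
  have "1 - t \<le> (\<Sum>k\<le>K. a 0 * (1 + e) ^ K * (\<mu> ^ k / fact k))"
    using mass sum_mono[of "{..K}" a, OF upper] by (smt (verit) atMost_iff)
  also have "\<dots> = a 0 * (1 + e) ^ K * (\<Sum>k\<le>K. \<mu> ^ k / fact k)"
    by (simp add: sum_distrib_left)
  also have "\<dots> \<le> x"
    unfolding x_def using sum_le_exp[of \<mu> K] \<mu> a[of 0] e by (intro mult_left_mono) auto
  finally have x: "1 - t \<le> x" .
  \<comment> \<open>Bernoulli's inequality for \<open>\<rho> = 1 - 2 * e / (1 + e)\<close>.\<close>
  have "1 - 2 * real K * e \<le> 1 + K * (- (2 * e / (1 + e)))"
  proof -
    have "2 * e / (1 + e) \<le> 2 * e"
      using e mult_left_mono[of 1 "1 + e" e] by (simp add: field_simps)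
    then have "K * (2 * e / (1 + e)) \<le> K * (2 * e)" by (intro mult_left_mono) auto
    then show ?thesis by simp
  qed
  also have "\<dots> \<le> (1 + (- (2 * e / (1 + e)))) ^ K"
    by (rule Bernoulli_inequality) (use e in \<open>simp add: field_simps\<close>)
  also have "1 + (- (2 * e / (1 + e))) = \<rho>"
    using e by (simp add: \<rho>_def field_simps)
  finally have \<rho>: "1 - 2 * real K * e \<le> \<rho> ^ K" .
  have \<rho>0: "\<rho> ^ K \<ge> 0" using e by (simp add: \<rho>_def)
  have "1 - (t + 2 * real K * e) \<le> (1 - t) * (1 - 2 * real K * e)"
    using t e by (simp add: algebra_simps)
  also have "\<dots> \<le> (1 - t) * \<rho> ^ K"
    using \<rho> True by (intro mult_left_mono) auto
  also have "\<dots> \<le> x * \<rho> ^ K"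
    using x \<rho>0 by (intro mult_right_mono) auto
  also have "x * \<rho> ^ K = a 0 * (1 - e) ^ K * exp \<mu>"
    using e by (simp add: x_def \<rho>_def power_divide)
  finally have "(1 - (t + 2 * real K * e)) * (\<mu> ^ k / fact k * exp (- \<mu>))
      \<le> a 0 * (1 - e) ^ K * exp \<mu> * (\<mu> ^ k / fact k * exp (- \<mu>))"
    using \<mu> by (intro mult_right_mono) auto
  also have "\<dots> = a 0 * (1 - e) ^ K * (\<mu> ^ k / fact k)"
    by (simp add: exp_minus)
  also have "\<dots> \<le> a k" by (rule lower[OF k])
  finally show ?thesis .
qed

section \<open>The total variation estimate\<close>

context switching_setup
begin

lemma pmf_overlap: "pmf (matching_overlap_pmf V E F) (int k) = count k / card (perfect_matchings V E)"
proof -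
  let ?P = "perfect_matchings V E"
  have fin: "finite ?P" by (rule finite_perfect_matchings[OF simple_E])
  have "pmf (matching_overlap_pmf V E F) (int k)
      = measure (measure_pmf (pmf_of_set ?P)) ((\<lambda>M. int (card (M \<inter> F))) -` {int k})"
    unfolding matching_overlap_pmf_def by (simp add: pmf_map)
  also have "\<dots> = card (?P \<inter> (\<lambda>M. int (card (M \<inter> F))) -` {int k}) / card ?P"
    by (rule measure_pmf_of_set[OF perfect_matching_exists fin])
  also have "?P \<inter> (\<lambda>M. int (card (M \<inter> F))) -` {int k} = {M \<in> ?P. card (M \<inter> F) = k}"
    by auto
  finally show ?thesis by (simp add: count_def)
qed

lemma sum_count: "(\<Sum>k\<le>K. count k) = card {M \<in> perfect_matchings V E. card (M \<inter> F) \<le> K}"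
proof -
  have fin: "finite (perfect_matchings V E)" by (rule finite_perfect_matchings[OF simple_E])
  have "{M \<in> perfect_matchings V E. card (M \<inter> F) \<le> K}
      = (\<Union>k\<le>K. {M \<in> perfect_matchings V E. card (M \<inter> F) = k})" by auto
  also have "card \<dots> = (\<Sum>k\<le>K. count k)"
    unfolding count_def using fin by (intro card_UN_disjoint) auto
  finally show ?thesis by simp
qed

text \<open>Of the term \<open>3 * \<mu> / Suc K\<close>, two parts come from Markov's inequality
  for the overlap and one from the Poisson tail. The other term is \<open>2 * K * e\<close> with
  ratio error \<open>e = 10 * \<epsilon>\<close>.\<close>

lemma d_TV_bound:
  assumes r: "r > 0" and K: "real K \<le> u"
    and eps': "\<epsilon> \<le> 1 / 10" "real r \<le> \<epsilon> * d" "4 * u \<le> \<epsilon> * card V"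
  defines "\<mu> \<equiv> real r * card V / (2 * real d)"
  shows "d_TV (matching_overlap_pmf V E F) (map_pmf int (poisson_pmf \<mu>))
    \<le> 3 * \<mu> / Suc K + 20 * real K * \<epsilon>"
proof -
  let ?P = "perfect_matchings V E"
  define N where "N = card ?P"
  define a where "a k = count k / real N" for k
  have fin: "finite ?P" by (rule finite_perfect_matchings[OF simple_E])
  have N: "N > 0" using perfect_matching_exists fin by (simp add: N_def card_gt_0_iff)
  have n: "real (card V) > 0" and d: "real d > 0" using n_pos r_less by auto
  have \<mu>: "\<mu> > 0" using r n d by (simp add: \<mu>_def)
  have rn: "real r * card V = 2 * (\<mu> * d)" using d by (simp add: \<mu>_def)
  have e0: "\<epsilon> > 0" using eps(1) n by (smt (verit) divide_pos_pos)
  have Dd: "(1 - \<epsilon>) * d \<le> D" "real D \<le> d" using eps'(2) D_eq r by (auto simp: algebra_simps)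
  \<comment> \<open>Switch counts contribute \<open>1 + \<epsilon>\<close> and
    \<open>1 - \<epsilon>\<close>; a second \<open>1 - \<epsilon>\<close> stems from
    \<open>D \<ge> (1 - \<epsilon>) * d\<close> in one ratio and from the discarded arcs in the
    other. For \<open>\<epsilon> \<le> 1 / 10\<close> a total of \<open>10 * \<epsilon>\<close>
    suffices.\<close>
  have sq: "1 + \<epsilon> \<le> (1 + 10 * \<epsilon>) * ((1 - \<epsilon>) * (1 - \<epsilon>))"
    "(1 - 10 * \<epsilon>) * (1 + \<epsilon>) \<le> (1 - \<epsilon>) * (1 - \<epsilon>)"
  proof -
    have e2: "0 \<le> \<epsilon> * \<epsilon>" "\<epsilon> * \<epsilon> \<le> \<epsilon> * (1 / 10)"
      using e0 eps'(1) by (auto intro!: mult_left_mono)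
    have "0 \<le> \<epsilon> * (\<epsilon> * \<epsilon>)" using e0 by simp
    moreover have "(1 + 10 * \<epsilon>) * ((1 - \<epsilon>) * (1 - \<epsilon>))
        = 1 + 8 * \<epsilon> - 19 * (\<epsilon> * \<epsilon>) + 10 * (\<epsilon> * (\<epsilon> * \<epsilon>))"
      by (simp add: algebra_simps)
    ultimately show "1 + \<epsilon> \<le> (1 + 10 * \<epsilon>) * ((1 - \<epsilon>) * (1 - \<epsilon>))"
      using e2 e0 by linarith
    have "(1 - \<epsilon>) * (1 - \<epsilon>) - (1 - 10 * \<epsilon>) * (1 + \<epsilon>) = 7 * \<epsilon> + 11 * (\<epsilon> * \<epsilon>)"
      by (simp add: algebra_simps)
    moreover have "7 * \<epsilon> + 11 * (\<epsilon> * \<epsilon>) \<ge> 0" using e2 e0 by simp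
    ultimately show "(1 - 10 * \<epsilon>) * (1 + \<epsilon>) \<le> (1 - \<epsilon>) * (1 - \<epsilon>)" by simp
  qed
  have hi: "Suc k * a (Suc k) \<le> (1 + 10 * \<epsilon>) * \<mu> * a k" if k: "k < K" for k
  proof -
    let ?c = "real (count k)" and ?c' = "real (count (Suc k)) * real (Suc k)"
    have "real (Suc k) \<le> u" using k K by linarith
    then have "?c' * 2 * ((1 - \<epsilon>) * D) \<le> ?c * (2 * (\<mu> * d)) * (1 + \<epsilon>)"
      using count_upper[of k] unfolding rn by (simp only: mult_ac)
    moreover have "?c' * 2 * ((1 - \<epsilon>) * ((1 - \<epsilon>) * d)) \<le> ?c' * 2 * ((1 - \<epsilon>) * D)"
      using Dd eps(2) by (intro mult_left_mono) auto
    ultimately have "(2 * real d) * (?c' * ((1 - \<epsilon>) * (1 - \<epsilon>))) \<le> (2 * real d) * (?c * \<mu> * (1 + \<epsilon>))"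
      by (simp add: mult_ac)
    then have "?c' * ((1 - \<epsilon>) * (1 - \<epsilon>)) \<le> ?c * \<mu> * (1 + \<epsilon>)"
      using d by (simp only: mult_le_cancel_left_pos zero_less_mult_iff zero_less_numeral simp_thms)
    also have "\<dots> \<le> ?c * \<mu> * ((1 + 10 * \<epsilon>) * ((1 - \<epsilon>) * (1 - \<epsilon>)))"
      using sq(1) \<mu> by (intro mult_left_mono) auto
    finally have "?c' * ((1 - \<epsilon>) * (1 - \<epsilon>)) \<le> ((1 + 10 * \<epsilon>) * \<mu> * ?c) * ((1 - \<epsilon>) * (1 - \<epsilon>))"
      by (simp only: mult_ac)
    then have "?c' \<le> (1 + 10 * \<epsilon>) * \<mu> * ?c"
      using eps(2) by (simp add: mult_le_cancel_right)
    then have "?c' / N \<le> ((1 + 10 * \<epsilon>) * \<mu> * ?c) / N" by (intro divide_right_mono) auto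
    then show ?thesis by (simp only: a_def times_divide_eq_right mult_ac)
  qed
  have lo: "(1 - 10 * \<epsilon>) * \<mu> * a k \<le> Suc k * a (Suc k)" if k: "k < K" for k
  proof -
    let ?c = "real (count k)" and ?c' = "real (count (Suc k)) * real (Suc k)"
    have ku: "real (Suc k) \<le> u" using k K by linarith
    have "real r * (4 * u) \<le> real r * (\<epsilon> * card V)"
      using eps'(3) by (intro mult_left_mono) auto
    then have "(1 - \<epsilon>) * (real r * card V) \<le> real r * card V - 4 * r * u"
      by (simp add: algebra_simps)
    then have "?c * ((1 - \<epsilon>) * (real r * card V)) * (1 - \<epsilon>)
        \<le> ?c * (real r * card V - 4 * r * u) * (1 - \<epsilon>)"
      using eps(2) by (intro mult_right_mono mult_left_mono) auto
    also have "\<dots> \<le> ?c' * 2 * (1 + \<epsilon>) * D"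
      using count_lower[OF ku] by (simp only: mult_ac)
    also have "\<dots> \<le> ?c' * 2 * (1 + \<epsilon>) * d"
      using Dd e0 by (intro mult_left_mono) auto
    finally have "(2 * real d) * (?c * \<mu> * ((1 - \<epsilon>) * (1 - \<epsilon>))) \<le> (2 * real d) * (?c' * (1 + \<epsilon>))"
      unfolding rn by (simp only: mult_ac)
    then have *: "?c * \<mu> * ((1 - \<epsilon>) * (1 - \<epsilon>)) \<le> ?c' * (1 + \<epsilon>)"
      using d by (simp only: mult_le_cancel_left_pos zero_less_mult_iff zero_less_numeral simp_thms)
    have "?c * \<mu> * ((1 - 10 * \<epsilon>) * (1 + \<epsilon>)) \<le> ?c * \<mu> * ((1 - \<epsilon>) * (1 - \<epsilon>))"
      using sq(2) \<mu> by (intro mult_left_mono) auto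
    with * have "((1 - 10 * \<epsilon>) * \<mu> * ?c) * (1 + \<epsilon>) \<le> ?c' * (1 + \<epsilon>)"
      by (simp only: mult_ac)
    then have "(1 - 10 * \<epsilon>) * \<mu> * ?c \<le> ?c'"
      using e0 by (simp add: mult_le_cancel_right)
    then have "((1 - 10 * \<epsilon>) * \<mu> * ?c) / N \<le> ?c' / N" by (intro divide_right_mono) auto
    then show ?thesis by (simp only: a_def times_divide_eq_right mult_ac)
  qed
  have mass: "(\<Sum>k\<le>K. a k) \<ge> 1 - 2 * \<mu> / Suc K"
  proof -
    let ?X = "\<lambda>M. real (card (M \<inter> F))"
    let ?S = "\<Sum>M\<in>?P. ?X M"
    let ?B = "{M \<in> ?P. card (M \<inter> F) > K}" and ?G = "{M \<in> ?P. card (M \<inter> F) \<le> K}"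
    have "?S * 2 * (1 - \<epsilon>) * d \<le> N * (2 * (\<mu> * d)) * (1 + \<epsilon>)"
      using sum_overlap_le unfolding rn N_def .
    then have "(2 * real d) * (?S * (1 - \<epsilon>)) \<le> (2 * real d) * (N * \<mu> * (1 + \<epsilon>))"
      by (simp only: mult_ac)
    then have "?S * (1 - \<epsilon>) \<le> N * \<mu> * (1 + \<epsilon>)"
      using d by (simp only: mult_le_cancel_left_pos zero_less_mult_iff zero_less_numeral simp_thms)
    \<comment> \<open>The mean overlap is at most \<open>2 * \<mu>\<close>, crudely, since
      \<open>\<epsilon>\<close> is small.\<close>
    also have "\<dots> \<le> N * \<mu> * (2 * (1 - \<epsilon>))"
      using eps'(1) \<mu> by (intro mult_left_mono) auto
    finally have "?S * (1 - \<epsilon>) \<le> (2 * \<mu> * N) * (1 - \<epsilon>)" by (simp only: mult_ac)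
    then have S: "?S \<le> 2 * \<mu> * N" using eps(2) by (simp add: mult_le_cancel_right)
    have "card ?B * real (Suc K) = (\<Sum>M\<in>?B. real (Suc K))" by simp
    also have "\<dots> \<le> (\<Sum>M\<in>?B. ?X M)" by (intro sum_mono) auto
    also have "\<dots> \<le> ?S" using fin by (intro sum_mono2) auto
    finally have B: "card ?B * real (Suc K) \<le> 2 * \<mu> * N" using S by linarith
    have "?P = ?G \<union> ?B" by auto
    then have "N = card ?G + card ?B"
      unfolding N_def using fin by (subst card_Un_disjoint[symmetric]) auto
    then have G: "real (card ?G) = real N - card ?B" by linarith
    have "(\<Sum>k\<le>K. a k) = real (\<Sum>k\<le>K. count k) / N"
      by (simp add: a_def sum_divide_distrib)
    also have "\<dots> = 1 - card ?B / N"
      unfolding sum_count G using N by (simp add: diff_divide_distrib)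
    finally have "(\<Sum>k\<le>K. a k) = 1 - card ?B / N" .
    moreover have "card ?B / N \<le> 2 * \<mu> / Suc K"
      using B N by (simp add: field_simps del: of_nat_Suc)
    ultimately show ?thesis by linarith
  qed
  have main: "(1 - (2 * \<mu> / Suc K + 20 * real K * \<epsilon>)) * pmf (map_pmf int (poisson_pmf \<mu>)) z
      \<le> pmf (matching_overlap_pmf V E F) z" if "z \<in> int ` {..K}" for z
  proof -
    from that obtain k where z: "z = int k" and "k \<in> {..K}" by (rule imageE)
    then have k: "z = int k" "k \<le> K" by simp_all
    have "(1 - (2 * \<mu> / Suc K + 2 * real K * (10 * \<epsilon>))) * (\<mu> ^ k / fact k * exp (- \<mu>)) \<le> a k"
      by (rule poisson_lower_bound_of_ratios[OF \<mu> _ _ _ lo hi mass _ k(2)])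
        (use e0 eps'(1) \<mu> in \<open>auto simp: a_def\<close>)
    moreover have "pmf (map_pmf int (poisson_pmf \<mu>)) z = \<mu> ^ k / fact k * exp (- \<mu>)"
      using \<mu> unfolding k(1) by (subst pmf_map_inj') auto
    ultimately show ?thesis
      using pmf_overlap[of k] by (simp add: a_def N_def k(1) mult_ac)
  qed
  have "d_TV (matching_overlap_pmf V E F) (map_pmf int (poisson_pmf \<mu>))
      \<le> (2 * \<mu> / Suc K + 20 * real K * \<epsilon>)
        + measure (measure_pmf (map_pmf int (poisson_pmf \<mu>))) (- int ` {..K})"
    by (rule d_TV_le[OF _ main]) (use \<mu> e0 in auto)
  also have "measure (measure_pmf (map_pmf int (poisson_pmf \<mu>))) (- int ` {..K})
      = measure (measure_pmf (poisson_pmf \<mu>)) {Suc K..}"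
  proof -
    have "int -` (- int ` {..K}) = {Suc K..}" by auto
    then show ?thesis by simp
  qed
  also have "\<dots> \<le> \<mu> / Suc K" by (rule poisson_tail[OF \<mu>])
  finally show ?thesis by (simp add: add_divide_distrib[symmetric])
qed

end

theorem theorem3p1:
  shows "\<forall>\<delta>::real. \<delta> > 0 \<longrightarrow> (\<exists>\<tau>::real. \<tau> > 0 \<and> (\<forall>\<nu>::real. \<nu> > 0 \<longrightarrow>
    (\<exists>(n\<^sub>0::nat) (\<eta>::nat \<Rightarrow> real). (\<forall>n. 0 \<le> \<eta> n) \<and> \<eta> \<longlonglongrightarrow> 0 \<and>
      (\<forall>(n::nat) (d::nat) (r::nat) (V::'a set) (E::'a set set) (F::'a set set).
         n \<ge> n\<^sub>0 \<and> even n \<and> real d \<ge> \<delta> * real n \<and> r > 0 \<and> real r \<le> real n powr (1 / 50) \<and>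
         card V = n \<and> regular_graph V E d \<and> robust_expander \<nu> \<tau> V E \<and>
         spanning_subgraph V F E \<and> regular_graph V F r
         \<longrightarrow> d_TV (matching_overlap_pmf V E F)
                (map_pmf int (poisson_pmf (real r * real n / (2 * real d)))) \<le> \<eta> n))))"
proof (intro allI impI)
  fix \<delta> :: real assume \<delta>: "\<delta> > 0"
  show "\<exists>\<tau>>0. \<forall>\<nu>>0. \<exists>(n\<^sub>0::nat) (\<eta>::nat \<Rightarrow> real). (\<forall>n. 0 \<le> \<eta> n) \<and> \<eta> \<longlonglongrightarrow> 0 \<and>
      (\<forall>(n::nat) (d::nat) (r::nat) (V::'a set) (E::'a set set) (F::'a set set).
         n \<ge> n\<^sub>0 \<and> even n \<and> real d \<ge> \<delta> * real n \<and> r > 0 \<and> real r \<le> real n powr (1 / 50) \<and>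
         card V = n \<and> regular_graph V E d \<and> robust_expander \<nu> \<tau> V E \<and>
         spanning_subgraph V F E \<and> regular_graph V F r
         \<longrightarrow> d_TV (matching_overlap_pmf V E F)
                (map_pmf int (poisson_pmf (real r * real n / (2 * real d)))) \<le> \<eta> n)"
  proof (intro exI[of _ "\<delta> / 4"] conjI allI impI)
    \<comment> \<open>Without \<open>F\<close> the degree is still at least
      \<open>\<delta> / 2 * n\<close>, which is twice \<open>\<delta> / 4 * n\<close> as the filling
      step of the heavy sets demands.\<close>
    show "\<delta> / 4 > 0" using \<delta> by simp
    fix \<nu> :: real assume \<nu>: "\<nu> > 0"
    \<comment> \<open>The bound of \<open>d_TV_bound\<close> with the mean at most n powr (1/50) /
      (2 \<open>\<delta>\<close>), cutoff n powr (1/10) and error n powr (-1/2).\<close>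
    define \<eta> :: "nat \<Rightarrow> real" where
      "\<eta> n = 3 / (2 * \<delta>) * (real n powr (1 / 50) / real n powr (1 / 10))
        + 20 * real n powr (1 / 10) * real n powr (-1/2)" for n
    \<comment> \<open>The error n powr (-1/2) has to dominate the path error, \<open>r / d\<close>,
      \<open>4 * u / n\<close> and \<open>1 / n\<close>; moreover \<open>r\<close> may take away at
      most half of \<open>\<nu> * n\<close> and of \<open>\<delta> * n\<close>.\<close>
    let ?C = "\<lambda>n::nat. path_error (\<delta> / 2) (\<nu> / 2) n (4 + 2 * real n powr (1 / 10)) \<le> real n powr (-1/2)
      \<and> real n powr (1 / 50) \<le> \<nu> / 2 * n \<and> real n powr (1 / 50) \<le> \<delta> / 2 * n
      \<and> real n powr (-1/2) \<le> 1 / 10 \<and> real n powr (1 / 50) \<le> real n powr (-1/2) * (\<delta> * n)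
      \<and> 4 * real n powr (1 / 10) \<le> real n powr (-1/2) * n \<and> 1 / real n \<le> real n powr (-1/2) \<and> n \<ge> 1"
    have "eventually ?C at_top"
    proof (intro eventually_conj)
      show "eventually (\<lambda>n. path_error (\<delta> / 2) (\<nu> / 2) n (4 + 2 * real n powr (1 / 10))
          \<le> real n powr (-1/2)) at_top"
        using \<delta> \<nu> by (intro path_error_small) auto
    qed (use \<delta> \<nu> in real_asymp)+
    then obtain n\<^sub>0 where n0: "\<And>n. n \<ge> n\<^sub>0 \<Longrightarrow> ?C n"
      by (auto simp: eventually_at_top_linorder)
    show "\<exists>(n\<^sub>0::nat) (\<eta>::nat \<Rightarrow> real). (\<forall>n. 0 \<le> \<eta> n) \<and> \<eta> \<longlonglongrightarrow> 0 \<and>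
      (\<forall>(n::nat) (d::nat) (r::nat) (V::'a set) (E::'a set set) (F::'a set set).
         n \<ge> n\<^sub>0 \<and> even n \<and> real d \<ge> \<delta> * real n \<and> r > 0 \<and> real r \<le> real n powr (1 / 50) \<and>
         card V = n \<and> regular_graph V E d \<and> robust_expander \<nu> (\<delta> / 4) V E \<and>
         spanning_subgraph V F E \<and> regular_graph V F r
         \<longrightarrow> d_TV (matching_overlap_pmf V E F)
                (map_pmf int (poisson_pmf (real r * real n / (2 * real d)))) \<le> \<eta> n)"
    proof (intro exI[of _ n\<^sub>0] exI[of _ \<eta>] conjI allI impI; (elim conjE)?)
      show "0 \<le> \<eta> n" for n using \<delta> by (simp add: \<eta>_def)
      show "\<eta> \<longlonglongrightarrow> 0" unfolding \<eta>_def using \<delta> by real_asymp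
      fix n d r :: nat and V :: "'a set" and E F :: "'a set set"
      assume n: "n\<^sub>0 \<le> n" and "even n" and d: "\<delta> * real n \<le> real d" and r: "0 < r"
        "real r \<le> real n powr (1 / 50)" and V: "card V = n" and E: "regular_graph V E d"
        and rob: "robust_expander \<nu> (\<delta> / 4) V E" and sub: "spanning_subgraph V F E"
        and F: "regular_graph V F r"
      from n0[OF n] have C: "path_error (\<delta> / 2) (\<nu> / 2) n (4 + 2 * real n powr (1 / 10)) \<le> real n powr (-1/2)"
        "real n powr (1 / 50) \<le> \<nu> / 2 * n" "real n powr (1 / 50) \<le> \<delta> / 2 * n"
        "real n powr (-1/2) \<le> 1 / 10" "real n powr (1 / 50) \<le> real n powr (-1/2) * (\<delta> * n)"
        "4 * real n powr (1 / 10) \<le> real n powr (-1/2) * n" "1 / real n \<le> real n powr (-1/2)" "n \<ge> 1"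
        by blast+
      define u where "u = real n powr (1 / 10)"
      define K where "K = nat \<lfloor>u\<rfloor>"
      have u: "u \<ge> 0" by (simp add: u_def)
      have K: "real K \<le> u" "u \<le> Suc K" unfolding K_def using u by linarith+
      have FE: "F \<subseteq> E" using sub by (simp add: spanning_subgraph_def)
      have finV: "finite V" using E by (simp add: regular_graph_def simple_graph_def)
      have sF: "simple_graph V F" using F by (simp add: regular_graph_def)
      have rob': "robust_expander (\<nu> / 2) (\<delta> / 4) V (E - F)"
      proof (rule robust_expander_mono[OF rob _ _ finV])
        fix v S assume v: "v \<in> V" "\<nu> * card V \<le> card (neighbours E v \<inter> S)"
        \<comment> \<open>Deleting \<open>F\<close> costs each vertex only \<open>r\<close>
          neighbours, at most half of the required \<open>\<nu> * n\<close>.\<close>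
        have "card (neighbours E v \<inter> S) \<le> card ((neighbours (E - F) v \<inter> S) \<union> neighbours F v)"
          using finite_neighbours[OF sF] finite_neighbours[of V E] E
          by (intro card_mono) (auto simp: neighbours_Diff regular_graph_def)
        also have "\<dots> \<le> card (neighbours (E - F) v \<inter> S) + card (neighbours F v)"
          by (rule card_Un_le)
        also have "card (neighbours F v) = r" using F v by (simp add: regular_graph_def)
        finally have "\<nu> * card V \<le> card (neighbours (E - F) v \<inter> S) + real r"
          using v(2) by linarith
        moreover have "real r \<le> \<nu> / 2 * card V" using r C(2) unfolding V by linarith
        ultimately show "\<nu> / 2 * card V \<le> card (neighbours (E - F) v \<inter> S)" by simp
      qed (use \<nu> in auto)
      have "real r \<le> \<delta> / 2 * n" using r C by linarith
      then have dr: "real d - real r \<ge> \<delta> / 2 * n" using d by simp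
      interpret switching_setup V E F d r "\<nu> / 2" "\<delta> / 4" "\<delta> / 2" "real n powr (-1/2)" u
        using E F FE V \<open>even n\<close> \<nu> \<delta> rob' dr C u
        by unfold_locales (auto simp: u_def)
      have \<mu>: "real r * n / (2 * real d) \<le> real n powr (1 / 50) / (2 * \<delta>)"
      proof -
        have n0: "real n > 0" using C by simp
        have "real r * n / (2 * real d) \<le> real r * n / (2 * (\<delta> * n))"
          using d \<delta> n0 by (intro divide_left_mono) (auto intro!: mult_pos_pos order.strict_trans2[OF _ d])
        also have "\<dots> = real r / (2 * \<delta>)" using n0 by simp
        also have "\<dots> \<le> real n powr (1 / 50) / (2 * \<delta>)"
          using r \<delta> by (intro divide_right_mono) auto
        finally show ?thesis .
      qed
      have "real n powr (-1/2) * (\<delta> * n) \<le> real n powr (-1/2) * d"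
        using d by (intro mult_left_mono) auto
      then have "real r \<le> real n powr (-1/2) * d" using r C by linarith
      then have "d_TV (matching_overlap_pmf V E F) (map_pmf int (poisson_pmf (real r * card V / (2 * real d))))
          \<le> 3 * (real r * card V / (2 * real d)) / Suc K + 20 * real K * real n powr (-1/2)"
        using C V by (intro d_TV_bound[OF r(1) K(1)]) (auto simp: u_def)
      also have "3 * (real r * card V / (2 * real d)) / Suc K
          \<le> 3 * (real n powr (1 / 50) / (2 * \<delta>)) / u"
        using \<mu> V K C \<delta> by (intro frac_le) (auto simp: u_def)
      also have "20 * real K * real n powr (-1/2) \<le> 20 * u * real n powr (-1/2)"
        using K by (intro mult_right_mono) auto
      finally show "d_TV (matching_overlap_pmf V E F)
          (map_pmf int (poisson_pmf (real r * real n / (2 * real d)))) \<le> \<eta> n"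
        using V by (simp add: \<eta>_def u_def)
    qed
  qed
qed

end
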